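(* Let $N\ge2$, let $\Omega\subset\mathbb{R}^N$ be a bounded Lipschitz domain and let $s\in(0,1)$. Let $p\in C(\mathbb{R}^N\times\mathbb{R}^N)$ be symmetric (i.e. $p(x,y)=p(y,x)$ for all $x,y\in\mathbb{R}^N$) with $$1<\inf_{(x,y)\in\mathbb{R}^N\times\mathbb{R}^N}p(x,y)\le\sup_{(x,y)\in\mathbb{R}^N\times\mathbb{R}^N}p(x,y)<\frac Ns,$$ and write $p(x):=p(x,x)$ and $p_s^*(x):=\frac{Np(x)}{N-sp(x)}$. Assume that $$\inf_{\epsilon>0}\ \sup_{\substack{(x,y)\in\mathbb{R}^N\times\mathbb{R}^N\\0<|x-y|<1/2}}\Big|p(x,y)-p^-_{B_\epsilon(x,y)}\Big|\log\frac1{|x-y|}<\infty,\qquad\text{where } p^-_{B_\epsilon(x,y)}:=\inf_{(x',y')\in B_\epsilon(x,y)}p(x',y').$$ Let $f:\Omega\times\mathbb{R}\to\mathbb{R}$ be a Carathéodory function for which there exist a constant $C_0>0$ and $q\in C_+(\overline\Omega)$ with $q(x)<p_s^*(x)$ for all $x\in\overline\Omega$ such that $$|f(x,t)|\le C_0\big(1+|t|^{q(x)-1}\big)\quad\text{for a.e. }x\in\Omega\text{ and all }t\in\mathbb{R}.$$ Then every weak solution $u$ of the problem $$(-\Delta)^s_{p(x)}u=f(x,u)\ \text{ in }\Omega,\qquad u=0\ \text{ in }\mathbb{R}^N\setminus\Omega,$$ belongs to $L^\infty(\Omega)$, and there exist constants $C,\tau_1,\tau_2$, independent of $u$, such that $$\|u\|_{L^\infty(\Omega)}\le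 C\max\Big\{\|u\|_{L^{\widetilde q(\cdot)}(\Omega)}^{\tau_1},\ \|u\|_{L^{\widetilde q(\cdot)}(\Omega)}^{\tau_2}\Big\},\qquad \widetilde q(x):=\max\{p(x),q(x)\}.$$
   Context: $B_\epsilon(x,y)$ is the open ball of radius $\epsilon$ centered at $(x,y)$ in $\mathbb{R}^N\times\mathbb{R}^N=\mathbb{R}^{2N}$. $C_+(\overline\Omega)$ is the set of $h\in C(\overline\Omega)$ with $1<\inf_{\overline\Omega}h\le\sup_{\overline\Omega}h<\infty$. For a domain $D\subset\mathbb{R}^N$ and a continuous exponent $h$ on $\overline D$ with $1<\inf h\le\sup h<\infty$, $L^{h(\cdot)}(D)$ is the set of measurable $u:D\to\mathbb{R}$ with $\int_D|u(x)|^{h(x)}\,dx<\infty$, with norm $\|u\|_{L^{h(\cdot)}(D)}=\inf\{\lambda>0:\int_D|u(x)/\lambda|^{h(x)}\,dx\le1\}$. $W^{s,p(\cdot,\cdot)}(\mathbb{R}^N)$ is the space of $u\in L^{p(\cdot)}(\mathbb{R}^N)$ (exponent $p(x)=p(x,x)$) such that $\int_{\mathbb{R}^N}\int_{\mathbb{R}^N}\frac{|u(x)-u(y)|^{p(x,y)}}{|x-y|^{N+sp(x,y)}}\,dx\,dy<\infty$, and $$W_0^{s,p(\cdot,\cdot)}(\Omega):=\{u\in W^{s,p(\cdot,\cdot)}(\mathbb{R}^N): u=0\text{ in }\mathbb{R}^N\setminus\Omega\}.$$ The fractional $p(\cdot)$-Laplacian is $$(-\Delta)^s_{p(x)}u(x)=2\lim_{\varepsilon\searrow0}\int_{\mathbb{R}^N\setminus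 B_\varepsilon(x)}\frac{|u(x)-u(y)|^{p(x,y)-2}(u(x)-u(y))}{|x-y|^{N+sp(x,y)}}\,dy.$$ A (weak) solution of the problem is a function $u\in W_0^{s,p(\cdot,\cdot)}(\Omega)$ such that $$\int_{\mathbb{R}^N}\int_{\mathbb{R}^N}\frac{|u(x)-u(y)|^{p(x,y)-2}(u(x)-u(y))(v(x)-v(y))}{|x-y|^{N+sp(x,y)}}\,dx\,dy=\int_\Omega f(x,u)v\,dx\quad\text{for all }v\in W_0^{s,p(\cdot,\cdot)}(\Omega).$$ (The integral on the right is finite because $W_0^{s,p(\cdot,\cdot)}(\Omega)$ is compactly imbedded in $L^{q(\cdot)}(\Omega)$.) *)

theory Defs
  imports "HOL-Analysis.Analysis" "HOL-Probability.Essential_Supremum"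
begin

text \<open>
  The boundary condition is the usual local one: near each boundary point, after a rotation, the set
  lies above the graph of a Lipschitz function. The rotation is encoded by the unit
  vector \<open>e\<close> playing the role of the last coordinate direction; the hyperplane orthogonal
  to \<open>e\<close> carries the remaining coordinates, and \<open>x - (x \<bullet> e) *\<^sub>R e\<close> is the projection
  onto it.
\<close>

definition lipschitz_boundary :: "'a::euclidean_space set \<Rightarrow> bool" where
  "lipschitz_boundary \<Omega> \<longleftrightarrow>
     (\<forall>x0 \<in> frontier \<Omega>. \<exists>r>0. \<exists>e L. \<exists>\<gamma> :: 'a \<Rightarrow> real.
        norm e = 1 \<and> L-lipschitz_on {y. y \<bullet> e = 0} \<gamma> \<and>
        \<Omega> \<inter> ball x0 r = {x \<in> ball x0 r. x \<bullet> e > \<gamma> (x - (x \<bullet> e) *\<^sub>R e)})"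

definition bounded_lipschitz_domain :: "'a::euclidean_space set \<Rightarrow> bool" where
  "bounded_lipschitz_domain \<Omega> \<longleftrightarrow>
     \<Omega> \<noteq> {} \<and> open \<Omega> \<and> connected \<Omega> \<and> bounded \<Omega> \<and> lipschitz_boundary \<Omega>"

text \<open>
  Infima and suprema whose finiteness is at stake are taken in the extended reals, since
  the real-valued \<open>Inf\<close> and \<open>Sup\<close> are unspecified on unbounded sets.
\<close>

definition C_plus :: "'a::euclidean_space set \<Rightarrow> ('a \<Rightarrow> real) set" where
  "C_plus K = {h. continuous_on K h \<and>
     1 < (INF x\<in>K. ereal (h x)) \<and> (SUP x\<in>K. ereal (h x)) < \<infinity>}"

definition Lvar :: "'a::euclidean_space set \<Rightarrow> ('a \<Rightarrow> real) \<Rightarrow> ('a \<Rightarrow> real) set" where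
  "Lvar D h = {u. u \<in> borel_measurable (lebesgue_on D) \<and>
     (\<integral>\<^sup>+x. ennreal (\<bar>u x\<bar> powr h x) \<partial>lebesgue_on D) < \<infinity>}"

definition Lvar_norm :: "'a::euclidean_space set \<Rightarrow> ('a \<Rightarrow> real) \<Rightarrow> ('a \<Rightarrow> real) \<Rightarrow> real" where
  "Lvar_norm D h u =
     Inf {l. 0 < l \<and> (\<integral>\<^sup>+x. ennreal (\<bar>u x / l\<bar> powr h x) \<partial>lebesgue_on D) \<le> 1}"

definition Linfty_norm :: "'a::euclidean_space set \<Rightarrow> ('a \<Rightarrow> real) \<Rightarrow> ereal" where
  "Linfty_norm D u = esssup (lebesgue_on D) (\<lambda>x. ereal \<bar>u x\<bar>)"

definition Linfty :: "'a::euclidean_space set \<Rightarrow> ('a \<Rightarrow> real) set" where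
  "Linfty D = {u. u \<in> borel_measurable (lebesgue_on D) \<and> Linfty_norm D u < \<infinity>}"

text \<open>
  Below, the integrands on the diagonal \<open>x = y\<close> have the value \<open>0\<close> (division by zero); the
  diagonal is a null set. When \<open>p (x, y) < 2\<close> and \<open>u x = u y\<close>, the factor
  \<open>\<bar>u x - u y\<bar> powr (p (x, y) - 2) * (u x - u y)\<close> is \<open>0\<close>, as is customary.
\<close>

definition Wsp :: "real \<Rightarrow> ((real^'n) \<times> (real^'n) \<Rightarrow> real) \<Rightarrow> (real^'n \<Rightarrow> real) set" where
  "Wsp s p = {u \<in> Lvar UNIV (\<lambda>x. p (x, x)).
     (\<integral>\<^sup>+(x, y). ennreal (\<bar>u x - u y\<bar> powr p (x, y)
          / norm (x - y) powr (real CARD('n) + s * p (x, y)))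
        \<partial>(lebesgue \<Otimes>\<^sub>M lebesgue)) < \<infinity>}"

definition Wsp0 ::
    "real \<Rightarrow> ((real^'n) \<times> (real^'n) \<Rightarrow> real) \<Rightarrow> (real^'n) set \<Rightarrow> (real^'n \<Rightarrow> real) set" where
  "Wsp0 s p \<Omega> = {u \<in> Wsp s p. AE x in lebesgue. x \<notin> \<Omega> \<longrightarrow> u x = 0}"

definition weak_solution ::
    "real \<Rightarrow> ((real^'n) \<times> (real^'n) \<Rightarrow> real) \<Rightarrow> (real^'n) set \<Rightarrow> (real^'n \<Rightarrow> real \<Rightarrow> real)
      \<Rightarrow> (real^'n \<Rightarrow> real) \<Rightarrow> bool" where
  "weak_solution s p \<Omega> f u \<longleftrightarrow>
     u \<in> Wsp0 s p \<Omega> \<and>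
     (\<forall>v \<in> Wsp0 s p \<Omega>.
        (\<integral>(x, y). \<bar>u x - u y\<bar> powr (p (x, y) - 2) * (u x - u y) * (v x - v y)
             / norm (x - y) powr (real CARD('n) + s * p (x, y))
           \<partial>(lebesgue \<Otimes>\<^sub>M lebesgue))
        = (\<integral>x. f x (u x) * v x \<partial>lebesgue_on \<Omega>))"

definition crit_exp :: "real \<Rightarrow> ((real^'n) \<times> (real^'n) \<Rightarrow> real) \<Rightarrow> real^'n \<Rightarrow> real" where
  "crit_exp s p x = real CARD('n) * p (x, x) / (real CARD('n) - s * p (x, x))"

definition log_holder_type :: "((real^'n) \<times> (real^'n) \<Rightarrow> real) \<Rightarrow> bool" where
  "log_holder_type p \<longleftrightarrow>
     (INF \<epsilon>\<in>{0<..}. SUP (x, y)\<in>{(x, y). 0 < norm (x - y) \<and> norm (x - y) < 1/2}.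
        ereal (\<bar>p (x, y) - (INF z\<in>ball (x, y) \<epsilon>. p z)\<bar> * ln (1 / norm (x - y)))) < \<infinity>"

definition caratheodory :: "'a::euclidean_space set \<Rightarrow> ('a \<Rightarrow> real \<Rightarrow> real) \<Rightarrow> bool" where
  "caratheodory \<Omega> f \<longleftrightarrow>
     (\<forall>t. (\<lambda>x. f x t) \<in> borel_measurable (lebesgue_on \<Omega>)) \<and>
     (AE x in lebesgue_on \<Omega>. continuous_on UNIV (f x))"

end

theory Submission
  imports Defs
begin

text \<open>
  Write \<open>E(v)\<close> for the Gagliardo energy of \<open>v\<close> with exponent \<open>p\<close>, \<open>r = max p q\<close> on the diagonal, and
  \<open>Z(k)\<close> for the integral of \<open>u\<^sup>r\<close> over the superlevel set \<open>{u > k}\<close>. Two inequalities carry the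
  proof.

  Testing the equation with the truncation \<open>(u - k)\<^sup>+\<close> gives, for \<open>k \<ge> 1\<close>, the energy bound
  \<open>E((u - k)\<^sup>+) \<le> 2 C0 Z(k)\<close> (\<open>caccioppoli_inequality\<close>).

  In the other direction, the energy controls a higher power of \<open>u\<close>, and this is a pointwise fact
  (\<open>pointwise_gain\<close>). Suppose \<open>u x = a\<close> lies well above \<open>k\<close>. By Chebyshev's inequality the set where
  \<open>u\<close> exceeds \<open>(a + k) / 2\<close> has measure at most about \<open>Z(k) / a powr r\<close> near \<open>x\<close>, so it fills at most half
  of the ball around \<open>x\<close> whose volume is twice that number. On the other half \<open>u\<close> has dropped by a
  fixed fraction of \<open>a\<close>, within the distance \<open>\<rho>\<close> given by \<open>\<rho> powr N \<sim> Z(k) / a powr r\<close>. Hence the inner energy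
  integral at \<open>x\<close> is at least of order
  \<open>(a / \<rho> powr s) powr p \<sim> a powr (p (1 + s r / N)) * Z(k) powr (- s p / N)\<close>.
  The exponent \<open>p (1 + s r / N)\<close> is larger than \<open>r\<close> exactly when \<open>r\<close> is below the critical exponent
  \<open>N p / (N - s p)\<close>. The gap is uniform on the compact closure of \<open>\<Omega>\<close>, so it survives the small losses
  \<open>\<epsilon>\<close> caused by the oscillation of \<open>p\<close> and \<open>r\<close> on small balls, and a gain \<open>\<theta> > 0\<close> in the exponent
  remains. This replaces a Sobolev embedding.

  Applied repeatedly, starting from \<open>u\<close> in the Lebesgue space with exponent \<open>p\<close>, the gain shows that
  \<open>\<bar>u\<bar> powr r\<close> is integrable over \<open>\<Omega>\<close>, with integral \<open>M\<close>, say (\<open>Wsp0_modular_finite\<close>). Combined with the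
  energy bound it yields \<open>Z(h) \<le> C k powr (- \<theta>) (1 + M) Z(k) powr (1 + s / N)\<close> for levels \<open>h > k\<close>, where \<open>C\<close>
  grows like a power of \<open>k / (h - k)\<close>. De Giorgi's iteration along the levels \<open>k (2 - 1 / 2 ^ i)\<close> then
  forces \<open>Z(2 k) = 0\<close> as soon as \<open>k\<close> is a suitable multiple of a power of \<open>1 + M\<close>
  (\<open>de_giorgi_upper_bound\<close>).

  The same holds for \<open>- u\<close>, so \<open>u\<close> is bounded by a power of \<open>1 + M\<close>. If \<open>\<Lambda>\<close> denotes the norm of \<open>u\<close> with
  exponent \<open>r\<close>, then \<open>M \<le> max 1 ((2 \<Lambda>) powr Q)\<close> for \<open>\<Lambda> > 0\<close>, and this gives the estimate with
  \<open>\<tau>1 = 0\<close>: the term \<open>\<Lambda> powr 0\<close> is \<open>1\<close> for \<open>\<Lambda> > 0\<close>, and it is \<open>0\<close> for \<open>\<Lambda> = 0\<close>, where \<open>u\<close> vanishes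
  almost everywhere.
\<close>

section \<open>Energies, truncations and superlevel sets\<close>

definition gagliardo_kernel ::
    "real \<Rightarrow> ('a::euclidean_space \<times> 'a \<Rightarrow> real) \<Rightarrow> ('a \<Rightarrow> real) \<Rightarrow> 'a \<Rightarrow> 'a \<Rightarrow> real" where
  "gagliardo_kernel s p v x y =
     \<bar>v x - v y\<bar> powr p (x, y) / norm (x - y) powr (real DIM('a) + s * p (x, y))"

definition gagliardo_energy ::
    "real \<Rightarrow> ('a::euclidean_space \<times> 'a \<Rightarrow> real) \<Rightarrow> ('a \<Rightarrow> real) \<Rightarrow> ennreal" where
  "gagliardo_energy s p v =
     (\<integral>\<^sup>+(x, y). ennreal (gagliardo_kernel s p v x y) \<partial>(lebesgue \<Otimes>\<^sub>M lebesgue))"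

definition excess :: "('a \<Rightarrow> real) \<Rightarrow> real \<Rightarrow> 'a \<Rightarrow> real" where
  "excess u k x = max 0 (u x - k)"

definition tail_modular ::
    "'a::euclidean_space set \<Rightarrow> ('a \<Rightarrow> real) \<Rightarrow> ('a \<Rightarrow> real) \<Rightarrow> real \<Rightarrow> ennreal" where
  "tail_modular \<Omega> m u k =
     (\<integral>\<^sup>+x. ennreal (u x powr m x) * indicator {x \<in> \<Omega>. k < u x} x \<partial>lebesgue)"

lemma sigma_finite_lebesgue: "sigma_finite_measure (lebesgue :: 'a::euclidean_space measure)"
proof -
  obtain A :: "'a set set" where A: "countable A" "A \<subseteq> sets lborel" "\<Union>A = space lborel"
      "\<forall>a\<in>A. emeasure lborel a \<noteq> \<infinity>"
    using lborel.sigma_finite_countable by blast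
  show ?thesis
  proof
    show "\<exists>A::'a set set. countable A \<and> A \<subseteq> sets lebesgue \<and> \<Union> A = space lebesgue \<and>
        (\<forall>a\<in>A. emeasure lebesgue a \<noteq> \<infinity>)"
      using A by (intro exI[of _ A]) auto
  qed
qed

section \<open>The pointwise gain of integrability\<close>

text \<open>
  The constants extracted from the continuity of the exponents and from subcriticality: on balls of
  radius \<open>\<rho>0\<close> the exponents lose at most \<open>\<epsilon>\<close>, and \<open>\<theta>\<close> is the gain of integrability. The assumption
  \<open>gain\<close> is where \<open>r\<close> being below the critical exponent enters: without \<open>\<epsilon>\<close> and \<open>\<theta>\<close> it reads
  \<open>m \<le> p (1 + s m / N)\<close>, which is \<open>m \<le> N p / (N - s p)\<close>.
\<close>

locale subcritical_growth =
  fixes s \<epsilon> \<rho>0 \<theta> p_hi Q :: real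
    and \<Omega> :: "'a::euclidean_space set"
    and p :: "'a \<times> 'a \<Rightarrow> real"
    and r :: "'a \<Rightarrow> real"
  assumes s_pos: "0 < s"
    and eps_pos: "0 < \<epsilon>" and rho0_pos: "0 < \<rho>0" and rho0_le_1: "\<rho>0 \<le> 1" and theta_pos: "0 < \<theta>"
    and sets_Omega [measurable]: "\<Omega> \<in> sets lebesgue"
    and p_borel [measurable]: "p \<in> borel_measurable borel"
    and r_measurable [measurable]: "r \<in> borel_measurable lebesgue"
    and p_ge_1: "\<And>z. 1 \<le> p z"
    and p_diag_ge: "\<And>x. 1 + \<epsilon> \<le> p (x, x)"
    and p_le: "\<And>z. p z \<le> p_hi"
    and s_p_hi: "s * p_hi \<le> real DIM('a)"
    and p_le_r: "\<And>x. x \<in> \<Omega> \<Longrightarrow> p (x, x) \<le> r x"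
    and r_le: "\<And>x. x \<in> \<Omega> \<Longrightarrow> r x \<le> Q"
    and osc_p: "\<And>x y. x \<in> \<Omega> \<Longrightarrow> dist x y < \<rho>0 \<Longrightarrow> p (x, x) - \<epsilon> \<le> p (x, y)"
    and osc_p_diag: "\<And>x y. x \<in> \<Omega> \<Longrightarrow> dist x y < \<rho>0 \<Longrightarrow> p (x, x) - \<epsilon> \<le> p (y, y)"
    and osc_r: "\<And>x y. x \<in> \<Omega> \<Longrightarrow> y \<in> \<Omega> \<Longrightarrow> dist x y < \<rho>0 \<Longrightarrow> r x - \<epsilon> \<le> r y"
    and gain: "\<And>x m. x \<in> \<Omega> \<Longrightarrow> p (x, x) \<le> m \<Longrightarrow> m \<le> r x \<Longrightarrow>
        m + \<theta> \<le> (p (x, x) - \<epsilon>) * (1 + s / real DIM('a) * (m - \<epsilon>))"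
begin

definition gain_const :: real where
  "gain_const = 4 powr p_hi * (2 / unit_ball_vol (real DIM('a))) * (1 + 2 / unit_ball_vol (real DIM('a))) * 2 powr Q"

lemma gain_const_pos: "0 < gain_const"
  unfolding gain_const_def by (intro mult_pos_pos add_pos_pos divide_pos_pos) auto

text \<open>
  Chebyshev's inequality for a variable exponent: on the superlevel set \<open>u\<close> is larger than \<open>t \<ge> 1\<close>, so
  \<open>u powr m\<close> can be bounded below with the smallest local value \<open>R\<close> of the exponent.
\<close>

lemma superlevel_measure_le:
  assumes [measurable]: "u \<in> borel_measurable lebesgue" "m \<in> borel_measurable lebesgue"
    and off: "AE y in lebesgue. y \<notin> \<Omega> \<longrightarrow> u y = 0"
    and m1: "\<And>y. y \<in> \<Omega> \<Longrightarrow> 1 \<le> m y"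
    and R: "\<And>y. y \<in> \<Omega> \<Longrightarrow> dist x y < \<rho> \<Longrightarrow> R \<le> m y"
    and k: "0 < k" "k \<le> l" and t: "1 \<le> t" "t \<le> l"
    and Z: "tail_modular \<Omega> m u k \<le> ennreal Z" "0 \<le> Z"
  shows "emeasure lebesgue {y \<in> ball x \<rho>. l < u y} \<le> ennreal (Z * t powr - R)"
proof -
  let ?S = "{y \<in> ball x \<rho>. l < u y}"
  have [measurable]: "ball x \<rho> \<in> sets lebesgue"
    by (simp add: lmeasurable_ball fmeasurableD)
  have S [measurable]: "?S \<in> sets lebesgue"
    by measurable
  have "ennreal (t powr R) * emeasure lebesgue ?S =
      (\<integral>\<^sup>+y. ennreal (t powr R) * indicator ?S y \<partial>lebesgue)"
    by (rule nn_integral_cmult_indicator[OF S, symmetric])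
  also have "\<dots> \<le> tail_modular \<Omega> m u k"
    unfolding tail_modular_def
  proof (rule nn_integral_mono_AE)
    show "AE y in lebesgue. ennreal (t powr R) * indicator ?S y
        \<le> ennreal (u y powr m y) * indicator {x \<in> \<Omega>. k < u x} y"
      using off
    proof eventually_elim
      case (elim y)
      show ?case
      proof (cases "y \<in> ?S")
        case True
        then have y: "y \<in> \<Omega>" "l < u y" "dist x y < \<rho>"
          using elim k by auto
        have "t powr R \<le> t powr m y"
          using t R[OF y(1,3)] by (intro powr_mono) auto
        also have "\<dots> \<le> u y powr m y"
          using t y m1[OF y(1)] by (intro powr_mono2) auto
        finally show ?thesis
          using y k by (auto intro!: ennreal_leI)
      qed auto
    qed
  qed
  also have "\<dots> \<le> ennreal Z" by (rule Z)
  finally have *: "ennreal (t powr R) * emeasure lebesgue ?S \<le> ennreal Z" .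
  have "emeasure lebesgue ?S = ennreal (t powr - R) * (ennreal (t powr R) * emeasure lebesgue ?S)"
    using t by (simp add: mult.assoc[symmetric] ennreal_mult[symmetric] powr_add[symmetric])
  also have "\<dots> \<le> ennreal (t powr - R) * ennreal Z"
    by (intro mult_left_mono *) auto
  also have "\<dots> = ennreal (Z * t powr - R)"
    using Z by (simp add: ennreal_mult[symmetric] mult.commute)
  finally show ?thesis .
qed

text \<open>
  Between \<open>x\<close> and a point \<open>y\<close> where \<open>u\<close> is at most \<open>(u x + k) / 2\<close> the truncation drops by at least
  \<open>\<kappa> u x / 4\<close>. Because \<open>u x / \<rho> powr s \<ge> 1\<close>, the exponent \<open>p (x, y)\<close> may be lowered to
  \<open>p (x, x) - \<epsilon>\<close>, which no longer depends on \<open>y\<close>.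
\<close>

lemma kernel_excess_ge:
  assumes x: "x \<in> \<Omega>" and k: "1 \<le> k" and kappa: "0 < \<kappa>" "\<kappa> \<le> 1"
    and ux: "k * (1 + \<kappa>) < u x" and uy: "u y \<le> (u x + k) / 2"
    and rho: "0 < \<rho>" "\<rho> \<le> \<rho>0" "dist x y < \<rho>"
  shows "(\<kappa> / 4) powr p_hi * (u x / \<rho> powr s) powr (p (x, x) - \<epsilon>) * \<rho> powr - real DIM('a)
      \<le> gagliardo_kernel s p (excess u k) x y"
proof -
  define a where "a = u x"
  define d where "d = norm (x - y)"
  define P where "P = p (x, y)"
  have P: "1 \<le> P" "P \<le> p_hi" "p (x, x) - \<epsilon> \<le> P"
    unfolding P_def using p_ge_1 p_le osc_p[OF x] rho by auto
  have ka: "k < a"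
    using ux k kappa unfolding a_def by (smt (verit) mult_less_cancel_left1)
  have "\<kappa> * a / 4 \<le> (a - k) / 2"
  proof -
    have "k * (1 + \<kappa>) * (2 - \<kappa>) \<le> a * (2 - \<kappa>)"
      using ux kappa unfolding a_def by (intro mult_right_mono) auto
    moreover have "2 * k \<le> k * (1 + \<kappa>) * (2 - \<kappa>)"
    proof -
      have "0 \<le> k * \<kappa> * (1 - \<kappa>)" using k kappa by auto
      then show ?thesis by (simp add: algebra_simps)
    qed
    ultimately show ?thesis by (simp add: algebra_simps)
  qed
  also have "(a - k) / 2 \<le> excess u k x - excess u k y"
    using uy ka unfolding excess_def a_def[symmetric] by (auto simp: max_def field_simps)
  finally have diff: "\<kappa> * a / 4 \<le> \<bar>excess u k x - excess u k y\<bar>" by linarith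
  have d: "0 < d" "d < \<rho>"
  proof -
    have "x \<noteq> y" using uy ka unfolding a_def by auto
    then show "0 < d" "d < \<rho>" using rho by (auto simp: d_def dist_norm)
  qed
  have rs: "\<rho> powr s \<le> 1"
    using rho rho0_le_1 s_pos by (intro powr_le1) auto
  have rs0: "0 < \<rho> powr s" using rho by simp
  have a_rs: "1 \<le> a / \<rho> powr s"
    using rs rs0 ka k by (simp add: field_simps)
  have "(\<kappa> / 4) powr p_hi * (a / \<rho> powr s) powr (p (x, x) - \<epsilon>) * \<rho> powr - real DIM('a)
      \<le> (\<kappa> / 4) powr P * (a / \<rho> powr s) powr P * \<rho> powr - real DIM('a)"
  proof (intro mult_right_mono mult_mono)
    show "(\<kappa> / 4) powr p_hi \<le> (\<kappa> / 4) powr P"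
      using P kappa by (intro powr_mono') auto
    show "(a / \<rho> powr s) powr (p (x, x) - \<epsilon>) \<le> (a / \<rho> powr s) powr P"
      using P a_rs by (intro powr_mono) auto
  qed auto
  also have "\<dots> = (\<kappa> * a / 4) powr P / \<rho> powr (real DIM('a) + s * P)"
    using kappa ka k rho
    by (simp add: powr_divide powr_mult powr_add powr_minus powr_powr field_simps)
  also have "\<dots> \<le> \<bar>excess u k x - excess u k y\<bar> powr P / d powr (real DIM('a) + s * P)"
    using diff kappa ka k rho d P s_pos by (intro frac_le powr_mono2) auto
  finally show ?thesis
    unfolding gagliardo_kernel_def a_def P_def d_def .
qed

lemma measurable_kernel_fst_arg [measurable]:
  assumes [measurable]: "v \<in> borel_measurable lebesgue"
  shows "(\<lambda>y. gagliardo_kernel s p v x y) \<in> borel_measurable lebesgue"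
proof -
  have "(\<lambda>y::'a. p (x, y)) \<in> borel_measurable borel" by measurable
  then have [measurable]: "(\<lambda>y::'a. p (x, y)) \<in> borel_measurable lebesgue"
    by (simp add: measurable_completion)
  have [measurable]: "(\<lambda>y::'a. norm (x - y)) \<in> borel_measurable lebesgue"
    by (intro measurable_completion) simp
  show ?thesis unfolding gagliardo_kernel_def by measurable
qed

text \<open>
  At least half of the ball of radius \<open>\<rho>\<close> around \<open>x\<close> consists of points to which
  \<open>kernel_excess_ge\<close> applies, so the energy density at \<open>x\<close> is large. The bound \<open>Z\<close> for the tail enters
  with a positive power, because a small tail forces \<open>u\<close> to drop within a short distance; this makes
  the iteration below superlinear.
  The condition \<open>small\<close> guarantees that the ball used in the proof has radius at most \<open>\<rho>0\<close>.
\<close>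

lemma pointwise_gain:
  assumes [measurable]: "u \<in> borel_measurable lebesgue" "m \<in> borel_measurable lebesgue"
    and off: "AE y in lebesgue. y \<notin> \<Omega> \<longrightarrow> u y = 0"
    and m: "\<And>y. y \<in> \<Omega> \<Longrightarrow> p (y, y) \<le> m y" "\<And>y. y \<in> \<Omega> \<Longrightarrow> m y \<le> r y"
    and osc: "\<And>x y. x \<in> \<Omega> \<Longrightarrow> y \<in> \<Omega> \<Longrightarrow> dist x y < \<rho>0 \<Longrightarrow> m x - \<epsilon> \<le> m y"
    and k: "2 \<le> k" and kappa: "0 < \<kappa>" "\<kappa> \<le> 1"
    and Z: "0 < Z" "tail_modular \<Omega> m u k \<le> ennreal Z"
    and small: "4 * Z \<le> k * (unit_ball_vol (real DIM('a)) * \<rho>0 ^ DIM('a))"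
    and x: "x \<in> \<Omega>" "k * (1 + \<kappa>) < u x"
  shows "ennreal (u x powr (m x + \<theta>))
    \<le> ennreal (gain_const * \<kappa> powr - p_hi * (Z powr (s / real DIM('a)) * (1 + Z)))
      * (\<integral>\<^sup>+y. ennreal (gagliardo_kernel s p (excess u k) x y) \<partial>lebesgue)"
proof -
  define n where "n = real DIM('a)"
  define w where "w = unit_ball_vol n"
  define a where "a = u x"
  define P where "P = p (x, x) - \<epsilon>"
  define R where "R = m x - \<epsilon>"
  define \<delta> where "\<delta> = s * P / n"
  \<comment> \<open>\<open>\<rho>\<close> is chosen so that the ball of radius \<open>\<rho>\<close> has twice the measure that Chebyshev allows for the superlevel set.\<close>
  define V where "V = 2 * Z * (a / 2) powr - R / w"
  define \<rho> where "\<rho> = V powr (1 / n)"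
  define L where "L = (\<kappa> / 4) powr p_hi * (a / \<rho> powr s) powr P"
  have n: "0 < n" unfolding n_def by simp
  have w: "0 < w" unfolding w_def n_def by simp
  have P1: "1 \<le> P" unfolding P_def using p_diag_ge[of x] by simp
  have Php: "P \<le> p_hi" unfolding P_def using p_le[of "(x, x)"] eps_pos by simp
  have R1: "1 \<le> R" unfolding R_def using p_diag_ge[of x] m(1)[OF x(1)] by simp
  have RQ: "R \<le> Q" unfolding R_def using m(2)[OF x(1)] r_le[OF x(1)] eps_pos by simp
  have ka: "k < a"
    using x(2) k kappa unfolding a_def by (smt (verit) mult_less_cancel_left1)
  have a2: "2 < a" using ka k by simp
  have d1: "s / n \<le> \<delta>" unfolding \<delta>_def using P1 s_pos n by (intro divide_right_mono) auto
  have d2: "\<delta> \<le> 1"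
  proof -
    have "s * P \<le> s * p_hi" using Php s_pos by simp
    also have "\<dots> \<le> n" using s_p_hi unfolding n_def by simp
    finally show ?thesis unfolding \<delta>_def using n by simp
  qed
  have d0: "0 < \<delta>" using d1 s_pos n by (smt (verit) divide_pos_pos)
  have V: "0 < V" unfolding V_def using Z a2 w by simp
  have rho: "0 < \<rho>" unfolding \<rho>_def using V by simp
  have rho_n: "\<rho> powr n = V" unfolding \<rho>_def using V n by (simp add: powr_powr)
  have rho_nat: "\<rho> ^ DIM('a) = V"
    using rho rho_n unfolding n_def by (simp add: powr_realpow)
  have rho_le: "\<rho> \<le> \<rho>0"
  proof -
    have "(a / 2) powr - R \<le> (a / 2) powr - 1" using a2 R1 by (intro powr_mono) auto
    also have "\<dots> = 2 / a" using a2 by (simp add: powr_minus_divide)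
    also have "\<dots> \<le> 2 / k" using ka k by (intro divide_left_mono) auto
    finally have "2 * Z * (a / 2) powr - R \<le> 2 * Z * (2 / k)"
      using Z by (intro mult_left_mono) auto
    also have "\<dots> \<le> w * \<rho>0 ^ DIM('a)"
      using small k unfolding w_def n_def by (simp add: field_simps)
    finally have "\<rho> ^ DIM('a) \<le> \<rho>0 ^ DIM('a)"
      unfolding rho_nat V_def using w by (simp add: field_simps)
    then show ?thesis using rho0_pos by (simp add: power_mono_iff rho less_imp_le)
  qed
  define S where "S = {y \<in> ball x \<rho>. (a + k) / 2 < u y}"
  define G where "G = {y \<in> ball x \<rho>. u y \<le> (a + k) / 2}"
  have [measurable]: "ball x \<rho> \<in> sets lebesgue"
    by (simp add: lmeasurable_ball fmeasurableD)
  have SG [measurable]: "S \<in> sets lebesgue" "G \<in> sets lebesgue"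
    unfolding S_def G_def by measurable
  have "emeasure lebesgue S \<le> ennreal (Z * (a / 2) powr - R)"
    unfolding S_def
  proof (rule superlevel_measure_le[where m = m and k = k])
    show "1 \<le> m y" if "y \<in> \<Omega>" for y
      using m(1)[OF that] p_ge_1[of "(y, y)"] by simp
    show "R \<le> m y" if "y \<in> \<Omega>" "dist x y < \<rho>" for y
      unfolding R_def using osc[OF x(1) that(1)] that rho_le by simp
  qed (use k ka a2 Z off in auto)
  also have "Z * (a / 2) powr - R = w * V / 2" unfolding V_def using w by simp
  finally have S_le: "emeasure lebesgue S \<le> ennreal (w * V / 2)" .
  have "ennreal (w * V) = emeasure lebesgue (ball x \<rho>)"
    using rho unfolding w_def n_def by (simp add: emeasure_ball rho_nat)
  also have "\<dots> = emeasure lebesgue (S \<union> G)"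
    by (rule arg_cong[where f = "emeasure lebesgue"]) (auto simp: S_def G_def)
  also have "\<dots> = emeasure lebesgue S + emeasure lebesgue G"
    by (intro plus_emeasure[symmetric] SG) (auto simp: S_def G_def)
  finally have "ennreal (w * V) \<le> ennreal (w * V / 2) + emeasure lebesgue G"
    using S_le by (simp add: add_right_mono)
  moreover have "ennreal (w * V) = ennreal (w * V / 2) + ennreal (w * V / 2)"
    using w V by (subst ennreal_plus[symmetric]) auto
  ultimately have G_ge: "ennreal (w * V / 2) \<le> emeasure lebesgue G"
    by (simp add: ennreal_add_left_cancel_le)
  let ?g = "\<integral>\<^sup>+y. ennreal (gagliardo_kernel s p (excess u k) x y) \<partial>lebesgue"
  have L0: "0 \<le> L" unfolding L_def by simp
  have "ennreal (L * \<rho> powr - n) * ennreal (w * V / 2)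
      \<le> ennreal (L * \<rho> powr - n) * emeasure lebesgue G"
    by (intro mult_left_mono G_ge) auto
  also have "\<dots> = (\<integral>\<^sup>+y. ennreal (L * \<rho> powr - n) * indicator G y \<partial>lebesgue)"
    by (subst nn_integral_cmult_indicator) auto
  also have "\<dots> \<le> ?g"
  proof (rule nn_integral_mono)
    fix y :: 'a
    show "ennreal (L * \<rho> powr - n) * indicator G y
        \<le> ennreal (gagliardo_kernel s p (excess u k) x y)"
    proof (cases "y \<in> G")
      case True
      then have "L * \<rho> powr - n \<le> gagliardo_kernel s p (excess u k) x y"
        unfolding L_def P_def n_def a_def
        using x k kappa rho rho_le by (intro kernel_excess_ge) (auto simp: G_def a_def)
      with True show ?thesis by (auto intro: ennreal_leI)
    qed auto
  qed
  finally have g_ge: "ennreal (L * w / 2) \<le> ?g"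
    using w V L0 rho n by (simp add: ennreal_mult[symmetric] powr_minus rho_n field_simps)
  \<comment> \<open>The rest eliminates \<open>\<rho>\<close>: \<open>\<rho> powr - (s * P)\<close> is \<open>V powr - \<delta>\<close>, which returns the factor \<open>a powr (\<delta> * R)\<close>.\<close>
  have "a powr (m x + \<theta>) \<le> a powr (P + \<delta> * R)"
    using gain[OF x(1) m(1)[OF x(1)] m(2)[OF x(1)]] a2 n
    by (intro powr_mono) (auto simp: P_def R_def \<delta>_def n_def field_simps)
  also have "\<dots> = a powr P * (a / 2) powr (\<delta> * R) * 2 powr (\<delta> * R)"
    using a2 by (simp add: powr_add powr_divide)
  also have "(a / 2) powr (\<delta> * R) = \<rho> powr - (s * P) * (2 / w) powr \<delta> * Z powr \<delta>"
  proof -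
    have "\<rho> powr - (s * P) = (\<rho> powr n) powr - \<delta>"
      using n by (simp add: powr_powr \<delta>_def)
    also have "\<dots> = V powr - \<delta>" unfolding rho_n ..
    also have "V = (2 / w) * Z * (a / 2) powr - R" unfolding V_def by simp
    also have "\<dots> powr - \<delta> = (2 / w) powr - \<delta> * Z powr - \<delta> * ((a / 2) powr - R) powr - \<delta>"
      by (simp only: powr_mult)
    also have "((a / 2) powr - R) powr - \<delta> = (a / 2) powr (\<delta> * R)"
      by (simp add: powr_powr mult.commute)
    finally show ?thesis using w Z by (simp add: powr_minus field_simps)
  qed
  also have "a powr P * (\<rho> powr - (s * P) * (2 / w) powr \<delta> * Z powr \<delta>) * 2 powr (\<delta> * R)
      = (a / \<rho> powr s) powr P * ((2 / w) powr \<delta> * 2 powr (\<delta> * R) * Z powr \<delta>)"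
    using a2 rho by (simp add: powr_divide powr_powr powr_minus field_simps)
  also have "(a / \<rho> powr s) powr P = L * 4 powr p_hi * \<kappa> powr - p_hi"
    unfolding L_def using kappa by (simp add: powr_divide powr_minus field_simps)
  also have "(2 / w) powr \<delta> * 2 powr (\<delta> * R) * Z powr \<delta>
      \<le> (1 + 2 / w) * 2 powr Q * (Z powr (s / n) * (1 + Z))"
  proof (intro mult_mono)
    have "(2 / w) powr \<delta> \<le> (1 + 2 / w) powr \<delta>"
      using w d0 by (intro powr_mono2) auto
    also have "\<dots> \<le> (1 + 2 / w) powr 1" using w d2 by (intro powr_mono) auto
    finally show "(2 / w) powr \<delta> \<le> 1 + 2 / w" using w by (simp add: add_pos_pos)
    have "\<delta> * R \<le> 1 * R" using d2 R1 by (intro mult_right_mono) auto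
    with RQ show "2 powr (\<delta> * R) \<le> 2 powr Q" by (intro powr_mono) auto
    \<comment> \<open>\<open>\<delta>\<close> varies with \<open>x\<close> between \<open>s / n\<close> and \<open>1\<close>; the power \<open>s / n\<close> is common to all \<open>x\<close>.\<close>
    have "Z powr \<delta> = Z powr (s / n) * Z powr (\<delta> - s / n)"
      using Z by (simp add: powr_add[symmetric])
    also have "\<dots> \<le> Z powr (s / n) * (1 + Z)"
    proof (intro mult_left_mono)
      have "Z powr (\<delta> - s / n) \<le> (1 + Z) powr (\<delta> - s / n)"
        using Z d1 by (intro powr_mono2) auto
      also have "\<dots> \<le> (1 + Z) powr 1" using Z d2 s_pos n
        by (intro powr_mono) (auto intro: order_trans[OF _ d2])
      finally show "Z powr (\<delta> - s / n) \<le> 1 + Z" using Z by simp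
    qed auto
    finally show "Z powr \<delta> \<le> Z powr (s / n) * (1 + Z)" .
  qed (use w in auto)
  finally have "a powr (m x + \<theta>) \<le> L * 4 powr p_hi * \<kappa> powr - p_hi *
      ((1 + 2 / w) * 2 powr Q * (Z powr (s / n) * (1 + Z)))"
    using L0 by (simp add: mult_left_mono)
  also have "\<dots> = (gain_const * \<kappa> powr - p_hi * (Z powr (s / n) * (1 + Z))) * (L * w / 2)"
    unfolding gain_const_def w_def[symmetric] n_def[symmetric] using w by (simp add: field_simps)
  finally have "ennreal (a powr (m x + \<theta>))
      \<le> ennreal (gain_const * \<kappa> powr - p_hi * (Z powr (s / n) * (1 + Z))) * ennreal (L * w / 2)"
    using gain_const_pos Z w L0 by (subst ennreal_mult[symmetric]) (auto intro: ennreal_leI)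
  also have "\<dots> \<le> ennreal (gain_const * \<kappa> powr - p_hi * (Z powr (s / n) * (1 + Z))) * ?g"
    by (intro mult_left_mono g_ge) auto
  finally show ?thesis unfolding a_def n_def .
qed

end

lemma tail_modular_mono:
  assumes "\<And>x. x \<in> \<Omega> \<Longrightarrow> k' < u x \<Longrightarrow> k < u x \<and> u x powr m' x \<le> u x powr m x"
  shows "tail_modular \<Omega> m' u k' \<le> tail_modular \<Omega> m u k"
  unfolding tail_modular_def
  by (intro nn_integral_mono) (auto simp: indicator_def intro!: ennreal_leI dest: assms)

lemma tail_modular_antimono: "k \<le> k' \<Longrightarrow> tail_modular \<Omega> m u k' \<le> tail_modular \<Omega> m u k"
  by (rule tail_modular_mono) auto

lemma excess_measurable [measurable]:
  assumes [measurable]: "u \<in> borel_measurable M"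
  shows "excess u k \<in> borel_measurable M"
  unfolding excess_def[abs_def] by measurable

lemma excess_diff_le: "\<bar>excess u k x - excess u k y\<bar> \<le> \<bar>u x - u y\<bar>"
  unfolding excess_def by (auto simp: max_def)

text \<open>
  The product of the completed measures is not complete, but its \<open>\<sigma>\<close>-algebra contains the Borel sets
  of the product space, which is enough for continuous exponents.
\<close>

lemma borel_measurable_pair_lebesgue:
  fixes p :: "'a::euclidean_space \<times> 'a \<Rightarrow> real"
  assumes "p \<in> borel_measurable borel"
  shows "p \<in> borel_measurable (lebesgue \<Otimes>\<^sub>M lebesgue)"
proof -
  have id: "(\<lambda>x::'a. x) \<in> borel_measurable lebesgue"
    by (intro measurable_completion) simp
  have "(\<lambda>z::'a \<times> 'a. (fst z, snd z)) \<in> (lebesgue \<Otimes>\<^sub>M lebesgue) \<rightarrow>\<^sub>M (borel \<Otimes>\<^sub>M borel)"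
    by (intro measurable_Pair measurable_compose[OF measurable_fst id]
        measurable_compose[OF measurable_snd id])
  then have "(\<lambda>z::'a \<times> 'a. z) \<in> (lebesgue \<Otimes>\<^sub>M lebesgue) \<rightarrow>\<^sub>M borel"
    by (simp add: borel_prod)
  from measurable_compose[OF this assms] show ?thesis by simp
qed

lemma borel_measurable_norm_diff_lebesgue:
  "(\<lambda>(x, y). norm (x - y :: 'a::euclidean_space)) \<in> borel_measurable (lebesgue \<Otimes>\<^sub>M lebesgue)"
  unfolding case_prod_beta
  by (intro borel_measurable_pair_lebesgue borel_measurable_continuous_onI continuous_intros)

lemma measurable_kernel:
  assumes [measurable]: "p \<in> borel_measurable borel" "v \<in> borel_measurable lebesgue"
  shows "(\<lambda>(x, y). gagliardo_kernel s p v x y) \<in> borel_measurable (lebesgue \<Otimes>\<^sub>M lebesgue)"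
proof -
  note [measurable] = borel_measurable_norm_diff_lebesgue[unfolded case_prod_beta]
    borel_measurable_pair_lebesgue[OF assms(1)]
  show ?thesis unfolding gagliardo_kernel_def case_prod_beta prod.collapse by measurable
qed

lemma energy_excess_le:
  assumes p: "\<And>z. 0 \<le> p z"
  shows "gagliardo_energy s p (excess u k) \<le> gagliardo_energy s p u"
  unfolding gagliardo_energy_def gagliardo_kernel_def
  using excess_diff_le[of u k] p
  by (intro nn_integral_mono)
    (auto split: prod.split intro!: ennreal_leI divide_right_mono powr_mono2)

context subcritical_growth
begin

lemma integrated_gain:
  assumes [measurable]: "u \<in> borel_measurable lebesgue" "m \<in> borel_measurable lebesgue"
    and off: "AE y in lebesgue. y \<notin> \<Omega> \<longrightarrow> u y = 0"
    and m: "\<And>y. y \<in> \<Omega> \<Longrightarrow> p (y, y) \<le> m y" "\<And>y. y \<in> \<Omega> \<Longrightarrow> m y \<le> r y"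
    and osc: "\<And>x y. x \<in> \<Omega> \<Longrightarrow> y \<in> \<Omega> \<Longrightarrow> dist x y < \<rho>0 \<Longrightarrow> m x - \<epsilon> \<le> m y"
    and k: "2 \<le> k" and kappa: "0 < \<kappa>" "\<kappa> \<le> 1"
    and Z: "0 < Z" "tail_modular \<Omega> m u k \<le> ennreal Z"
    and small: "4 * Z \<le> k * (unit_ball_vol (real DIM('a)) * \<rho>0 ^ DIM('a))"
  shows "tail_modular \<Omega> (\<lambda>x. m x + \<theta>) u (k * (1 + \<kappa>))
    \<le> ennreal (gain_const * \<kappa> powr - p_hi * (Z powr (s / real DIM('a)) * (1 + Z)))
      * gagliardo_energy s p (excess u k)"
proof -
  interpret L: sigma_finite_measure "lebesgue :: 'a measure" by (rule sigma_finite_lebesgue)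
  let ?c = "ennreal (gain_const * \<kappa> powr - p_hi * (Z powr (s / real DIM('a)) * (1 + Z)))"
  let ?K = "\<lambda>x y. ennreal (gagliardo_kernel s p (excess u k) x y)"
  have K [measurable]: "(\<lambda>(x, y). ?K x y) \<in> borel_measurable (lebesgue \<Otimes>\<^sub>M lebesgue)"
    using measurable_kernel[of p "excess u k" s] by (simp add: case_prod_beta)
  have "tail_modular \<Omega> (\<lambda>x. m x + \<theta>) u (k * (1 + \<kappa>))
      \<le> (\<integral>\<^sup>+x. ?c * (\<integral>\<^sup>+y. ?K x y \<partial>lebesgue) \<partial>lebesgue)"
    unfolding tail_modular_def
  proof (intro nn_integral_mono)
    fix x :: 'a
    show "ennreal (u x powr (m x + \<theta>)) * indicator {x \<in> \<Omega>. k * (1 + \<kappa>) < u x} x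
        \<le> ?c * (\<integral>\<^sup>+y. ?K x y \<partial>lebesgue)"
      using pointwise_gain[OF assms, of x] by (auto simp: indicator_def)
  qed
  also have "\<dots> = ?c * (\<integral>\<^sup>+x. \<integral>\<^sup>+y. ?K x y \<partial>lebesgue \<partial>lebesgue)"
    by (intro nn_integral_cmult) (use K in measurable)
  also have "(\<integral>\<^sup>+x. \<integral>\<^sup>+y. ?K x y \<partial>lebesgue \<partial>lebesgue) = gagliardo_energy s p (excess u k)"
    unfolding gagliardo_energy_def using L.nn_integral_fst[OF K] by simp
  finally show ?thesis .
qed

section \<open>A priori integrability and De Giorgi iteration\<close>

text \<open>
  The exponents \<open>min r (p + j \<theta>)\<close> climb from \<open>p\<close> to \<open>r\<close> in steps of \<open>\<theta>\<close>. They inherit the oscillation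
  bounds of \<open>p\<close> and \<open>r\<close>, and each step costs only the finite energy of \<open>u\<close> itself.
\<close>

lemma tail_modular_finite:
  assumes [measurable]: "u \<in> borel_measurable lebesgue"
    and off: "AE y in lebesgue. y \<notin> \<Omega> \<longrightarrow> u y = 0"
    and energy: "gagliardo_energy s p u < \<infinity>"
    and start: "tail_modular \<Omega> (\<lambda>x. p (x, x)) u 1 < \<infinity>"
  shows "\<exists>k\<ge>1. tail_modular \<Omega> r u k < \<infinity>"
proof -
  define W where "W = unit_ball_vol (real DIM('a)) * \<rho>0 ^ DIM('a)"
  have W: "0 < W" unfolding W_def using rho0_pos by simp
  define m where "m = (\<lambda>j x. min (r x) (p (x, x) + real j * \<theta>))"
  have "(\<lambda>x::'a. p (x, x)) \<in> borel_measurable borel" by measurable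
  then have [measurable]: "(\<lambda>x. p (x, x)) \<in> borel_measurable lebesgue"
    by (simp add: measurable_completion)
  have m_meas [measurable]: "m j \<in> borel_measurable lebesgue" for j
    unfolding m_def by measurable
  have step: "\<exists>k\<ge>1. tail_modular \<Omega> (m j) u k < \<infinity>" for j
  proof (induction j)
    case 0
    have "tail_modular \<Omega> (m 0) u 1 \<le> tail_modular \<Omega> (\<lambda>x. p (x, x)) u 1"
      by (rule tail_modular_mono) (auto simp: m_def intro!: powr_mono)
    with start show ?case by (intro exI[of _ 1]) auto
  next
    case (Suc j)
    then obtain k where k: "1 \<le> k" "tail_modular \<Omega> (m j) u k < \<infinity>" by blast
    define Z where "Z = enn2real (tail_modular \<Omega> (m j) u k) + 1"
    have Z: "0 < Z" "tail_modular \<Omega> (m j) u k \<le> ennreal Z"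
      unfolding Z_def using k(2)
      by (auto simp: add_nonneg_pos ennreal_enn2real_if intro!: order_trans[OF _ ennreal_leI, of _ "enn2real (tail_modular \<Omega> (m j) u k)"])
    define h where "h = max (max k 2) (4 * Z / W)"
    have h: "k \<le> h" "2 \<le> h" "4 * Z / W \<le> h"
      unfolding h_def by auto
    then have hW: "4 * Z \<le> h * W" using W by (simp add: field_simps)
    have "tail_modular \<Omega> (m (Suc j)) u (h * (1 + 1)) \<le> tail_modular \<Omega> (\<lambda>x. m j x + \<theta>) u (h * (1 + 1))"
    proof (rule tail_modular_mono)
      fix x assume x: "x \<in> \<Omega>" "h * (1 + 1) < u x"
      have "m (Suc j) x \<le> m j x + \<theta>"
        unfolding m_def using theta_pos by (auto simp: min_def algebra_simps)
      then show "h * (1 + 1) < u x \<and> u x powr m (Suc j) x \<le> u x powr (m j x + \<theta>)"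
        using x h by (auto intro!: powr_mono)
    qed
    also have "\<dots> \<le> ennreal (gain_const * 1 powr - p_hi * (Z powr (s / real DIM('a)) * (1 + Z)))
        * gagliardo_energy s p (excess u h)"
    proof (rule integrated_gain)
      show "p (y, y) \<le> m j y" if "y \<in> \<Omega>" for y
        unfolding m_def using p_le_r[OF that] theta_pos by auto
      show "m j x - \<epsilon> \<le> m j y" if "x \<in> \<Omega>" "y \<in> \<Omega>" "dist x y < \<rho>0" for x y
        unfolding m_def using osc_r[OF that] osc_p_diag[OF that(1,3)] by (auto simp: min_def)
      show "tail_modular \<Omega> (m j) u h \<le> ennreal Z"
        using tail_modular_antimono[OF h(1)] Z(2) by (rule order_trans)
    qed (use off h hW Z in \<open>auto simp: m_def W_def\<close>)
    also have "\<dots> < \<infinity>"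
      using energy energy_excess_le[of p s u h] order_trans[OF zero_le_one p_ge_1] by (auto simp: ennreal_mult_less_top)
    finally show ?case using h by (intro exI[of _ "h * (1 + 1)"]) auto
  qed
  obtain j :: nat where j: "Q \<le> real j * \<theta>"
    using theta_pos by (metis reals_Archimedean3 less_imp_le)
  have "\<And>x. x \<in> \<Omega> \<Longrightarrow> m j x = r x"
    unfolding m_def using j r_le p_ge_1 by (smt (verit) min_absorb1)
  then have "tail_modular \<Omega> (m j) u k = tail_modular \<Omega> r u k" for k
    by (intro antisym tail_modular_mono) auto
  with step[of j] show ?thesis by simp
qed

text \<open>
  The level \<open>k\<close> beyond which the iteration starts is \<open>sup_const A * (1 + M) powr sup_exponent\<close>. The three
  summands of \<open>sup_const\<close> serve, in this order, \<open>k \<ge> 2\<close>, the condition on the radius in the pointwise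
  gain, and the absorption of the iteration constants by \<open>k powr \<theta>\<close>.
\<close>

definition sup_exponent :: real where
  "sup_exponent = 1 + 2 / \<theta>"

definition sup_const :: "real \<Rightarrow> real" where
  "sup_const A = 2 + 4 / (unit_ball_vol (real DIM('a)) * \<rho>0 ^ DIM('a))
     + (2 * gain_const * 4 powr p_hi * A * 2 powr (p_hi / (s / real DIM('a)))) powr (1 / \<theta>)"

lemma sup_const_ge_2: "2 \<le> sup_const A"
  unfolding sup_const_def using rho0_pos by (simp add: less_imp_le)

text \<open>
  Along the levels \<open>l i\<close>, which increase from \<open>k\<close> to \<open>2 k\<close>, the tails are shown to decay like
  \<open>z i = (1 + M) / \<beta> ^ i\<close>. In one step the factor \<open>b ^ i\<close>, coming from the shrinking relative gap \<open>\<kappa> i\<close>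
  between the levels, is absorbed by the surplus power \<open>(z i) powr \<delta>\<close>, because \<open>\<beta> powr \<delta> = b\<close>. All
  other factors are absorbed by \<open>k powr \<theta>\<close>, which is why \<open>k\<close> is a power of \<open>1 + M\<close>.
\<close>

lemma de_giorgi_upper_bound:
  assumes [measurable]: "u \<in> borel_measurable lebesgue"
    and off: "AE y in lebesgue. y \<notin> \<Omega> \<longrightarrow> u y = 0"
    and A: "0 < A"
    and caccioppoli: "\<And>k. 1 \<le> k \<Longrightarrow>
      gagliardo_energy s p (excess u k) \<le> ennreal A * tail_modular \<Omega> r u k"
    and M: "0 \<le> M" "tail_modular \<Omega> r u 1 \<le> ennreal M"
  shows "AE x in lebesgue. x \<in> \<Omega> \<longrightarrow> u x \<le> 2 * (sup_const A * (1 + M) powr sup_exponent)"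
proof -
  define \<delta> where "\<delta> = s / real DIM('a)"
  define b where "b = 2 powr p_hi"
  define \<beta> where "\<beta> = 2 powr (p_hi / \<delta>)"
  define W where "W = unit_ball_vol (real DIM('a)) * \<rho>0 ^ DIM('a)"
  define D where "D = 2 * gain_const * b\<^sup>2 * A * \<beta>"
  define k where "k = sup_const A * (1 + M) powr sup_exponent"
  define \<kappa> where "\<kappa> = (\<lambda>i::nat. 1 / 2 ^ (i + 2) :: real)"
  define l where "l = (\<lambda>i::nat. k * (2 - 1 / 2 ^ i))"
  define z where "z = (\<lambda>i::nat. (1 + M) / \<beta> ^ i)"
  have W: "0 < W" unfolding W_def using rho0_pos by simp
  have p_hi1: "1 \<le> p_hi" using p_ge_1[of undefined] p_le[of undefined] by simp
  have d: "0 < \<delta>" "\<delta> \<le> 1"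
  proof -
    show "0 < \<delta>" unfolding \<delta>_def using s_pos by simp
    have "s * 1 \<le> s * p_hi" using s_pos p_hi1 by (intro mult_left_mono) auto
    also have "\<dots> \<le> real DIM('a)" by (rule s_p_hi)
    finally show "\<delta> \<le> 1" unfolding \<delta>_def by simp
  qed
  have b0: "0 < b" unfolding b_def by simp
  have beta: "1 < \<beta>" unfolding \<beta>_def using p_hi1 d by simp
  have D0: "0 < D" unfolding D_def using gain_const_pos b0 A beta by simp
  have b2: "b\<^sup>2 = 4 powr p_hi"
  proof -
    have "b\<^sup>2 = (2 * 2) powr p_hi" unfolding b_def power2_eq_square by (subst powr_mult) auto
    then show ?thesis by simp
  qed
  have const: "sup_const A = 2 + 4 / W + D powr (1 / \<theta>)"
    unfolding sup_const_def W_def D_def b2 \<beta>_def \<delta>_def by simp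
  have M1: "1 \<le> (1 + M) powr sup_exponent" "1 + M \<le> (1 + M) powr sup_exponent"
    using M(1) theta_pos ge_one_powr_ge_zero[of "1 + M" sup_exponent]
      powr_mono[of 1 sup_exponent "1 + M"] by (auto simp: sup_exponent_def)
  have k_ge: "2 \<le> k" "4 * (1 + M) / W \<le> k" "D powr (1 / \<theta>) * (1 + M) powr (2 / \<theta>) \<le> k"
  proof -
    show "2 \<le> k"
      using mult_mono[OF sup_const_ge_2[of A] M1(1)] sup_const_ge_2[of A] unfolding k_def by simp
    have "4 / W * (1 + M) \<le> sup_const A * (1 + M) powr sup_exponent"
      using M1 M W sup_const_ge_2[of A] by (intro mult_mono) (auto simp: const)
    then show "4 * (1 + M) / W \<le> k" unfolding k_def by simp
    show "D powr (1 / \<theta>) * (1 + M) powr (2 / \<theta>) \<le> k"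
      unfolding k_def using M W theta_pos
      by (intro mult_mono powr_mono) (auto simp: const sup_exponent_def)
  qed
  have k_theta: "D * (1 + M)\<^sup>2 \<le> k powr \<theta>"
  proof -
    have "D * (1 + M)\<^sup>2 = (D powr (1 / \<theta>) * (1 + M) powr (2 / \<theta>)) powr \<theta>"
      using D0 M theta_pos by (simp add: powr_mult powr_powr powr_numeral)
    also have "\<dots> \<le> k powr \<theta>"
      using k_ge(3) theta_pos by (intro powr_mono2) auto
    finally show ?thesis .
  qed
  have l_ge: "k \<le> l i" "l i \<le> 2 * k" for i
  proof -
    have "(1::real) \<le> 2 ^ i" by (rule one_le_power) simp
    then have "k * 1 \<le> k * (2 - 1 / 2 ^ i)"
      using k_ge(1) by (intro mult_left_mono) (auto simp: field_simps)
    then show "k \<le> l i" unfolding l_def by simp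
    have "k * (2 - 1 / 2 ^ i) \<le> k * 2"
      using k_ge(1) by (intro mult_left_mono) auto
    then show "l i \<le> 2 * k" unfolding l_def by simp
  qed
  have z_bd: "0 < z i" "z i \<le> 1 + M" for i
    unfolding z_def using M(1) beta by (auto simp: divide_le_eq intro: mult_left_mono[of 1, simplified])
  have main: "tail_modular \<Omega> r u (l i) \<le> ennreal (z i)" for i
  proof (induction i)
    case 0
    have "tail_modular \<Omega> r u (l 0) \<le> tail_modular \<Omega> r u 1"
      using k_ge(1) by (intro tail_modular_antimono) (simp add: l_def)
    also have "\<dots> \<le> ennreal M" by (rule M)
    also have "\<dots> \<le> ennreal (z 0)" by (intro ennreal_leI) (simp add: z_def)
    finally show ?case .
  next
    case (Suc i)
    define c where "c = gain_const * \<kappa> i powr - p_hi * (z i powr \<delta> * (1 + z i))"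
    have c0: "0 \<le> c" unfolding c_def using gain_const_pos z_bd[of i] by simp
    have level: "l i * (1 + \<kappa> i) \<le> l (Suc i)"
    proof -
      have "l i * \<kappa> i \<le> 2 * k * \<kappa> i"
        using l_ge(2)[of i] by (intro mult_right_mono) (auto simp: \<kappa>_def)
      also have "\<dots> = l (Suc i) - l i"
        unfolding \<kappa>_def l_def by (simp add: field_simps)
      finally show ?thesis by (simp add: algebra_simps)
    qed
    have gain_i: "tail_modular \<Omega> (\<lambda>x. r x + \<theta>) u (l i * (1 + \<kappa> i))
        \<le> ennreal c * gagliardo_energy s p (excess u (l i))"
      unfolding c_def \<delta>_def
    proof (rule integrated_gain)
      have "4 * z i \<le> 4 * (1 + M)" using z_bd(2)[of i] by simp
      also have "\<dots> \<le> k * W" using k_ge(2) W by (simp add: field_simps)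
      also have "\<dots> \<le> l i * W" using l_ge(1) W by (intro mult_right_mono) auto
      finally show "4 * z i \<le> l i * (unit_ball_vol (real DIM('a)) * \<rho>0 ^ DIM('a))"
        unfolding W_def .
      show "2 \<le> l i" using l_ge(1)[of i] k_ge(1) by simp
      have "(1::real) \<le> 2 ^ (i + 2)" by (rule one_le_power) simp
      then show "\<kappa> i \<le> 1" unfolding \<kappa>_def by simp
    qed (use off p_le_r osc_r Suc z_bd in \<open>auto simp: \<kappa>_def\<close>)
    have "ennreal (k powr \<theta>) * tail_modular \<Omega> r u (l (Suc i))
        \<le> tail_modular \<Omega> (\<lambda>x. r x + \<theta>) u (l (Suc i))"
    proof -
      have "ennreal (k powr \<theta>) * tail_modular \<Omega> r u (l (Suc i))
          = (\<integral>\<^sup>+x. ennreal (k powr \<theta>) *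
              (ennreal (u x powr r x) * indicator {x \<in> \<Omega>. l (Suc i) < u x} x) \<partial>lebesgue)"
        unfolding tail_modular_def by (rule nn_integral_cmult[symmetric]) measurable
      also have "\<dots> \<le> tail_modular \<Omega> (\<lambda>x. r x + \<theta>) u (l (Suc i))"
        unfolding tail_modular_def
      proof (intro nn_integral_mono)
        fix x
        have "k powr \<theta> * u x powr r x \<le> u x powr (r x + \<theta>)" if "l (Suc i) < u x"
        proof -
          have "k powr \<theta> \<le> u x powr \<theta>"
            using that l_ge(1)[of "Suc i"] k_ge(1) theta_pos by (intro powr_mono2) auto
          then show ?thesis by (simp add: powr_add mult.commute[of "u x powr r x"] mult_right_mono)
        qed
        then show "ennreal (k powr \<theta>) *
              (ennreal (u x powr r x) * indicator {x \<in> \<Omega>. l (Suc i) < u x} x)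
            \<le> ennreal (u x powr (r x + \<theta>)) * indicator {x \<in> \<Omega>. l (Suc i) < u x} x"
          by (auto simp: indicator_def ennreal_mult[symmetric] intro!: ennreal_leI)
      qed
      finally show ?thesis .
    qed
    also have "\<dots> \<le> tail_modular \<Omega> (\<lambda>x. r x + \<theta>) u (l i * (1 + \<kappa> i))"
      by (rule tail_modular_antimono[OF level])
    also have "\<dots> \<le> ennreal c * (ennreal A * ennreal (z i))"
      using gain_i caccioppoli[of "l i"] Suc l_ge(1)[of i] k_ge(1)
      by (meson dual_order.trans mult_left_mono one_le_numeral zero_le)
    also have "\<dots> = ennreal (c * A * z i)"
      using c0 A z_bd[of i] by (simp add: ennreal_mult[symmetric] mult.assoc)
    also have "\<dots> \<le> ennreal (k powr \<theta> * z (Suc i))"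
    proof (intro ennreal_leI)
      have "\<kappa> i powr - p_hi = (2 powr real (i + 2)) powr p_hi"
        unfolding \<kappa>_def by (subst powr_realpow) (auto simp: powr_minus powr_divide)
      also have "\<dots> = b powr real (i + 2)"
        unfolding b_def by (simp add: powr_powr mult.commute)
      also have "\<dots> = b ^ i * b\<^sup>2"
        using b0 by (subst powr_realpow) (auto simp: power_add power2_eq_square)
      finally have kap: "\<kappa> i powr - p_hi = b ^ i * b\<^sup>2" .
      have "\<beta> powr \<delta> = b" unfolding \<beta>_def b_def using d by (simp add: powr_powr)
      then have "(\<beta> ^ i) powr \<delta> = b ^ i"
        using beta b0 by (metis powr_powr mult.commute powr_realpow less_trans zero_less_one)
      then have zd: "z i powr \<delta> = (1 + M) powr \<delta> / b ^ i"
        unfolding z_def using M beta by (simp add: powr_divide)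
      have "(1 + M) powr \<delta> \<le> (1 + M) powr 1" using M d by (intro powr_mono) auto
      then have Md: "(1 + M) powr \<delta> \<le> 1 + M" using M by simp
      have "c = gain_const * b\<^sup>2 * ((1 + M) powr \<delta> * (1 + z i))"
        unfolding c_def kap zd using b0 by simp
      also have "\<dots> \<le> gain_const * b\<^sup>2 * ((1 + M) * (2 * (1 + M)))"
        using Md z_bd[of i] M gain_const_pos by (intro mult_left_mono mult_mono) auto
      finally have "c * A * z i \<le> gain_const * b\<^sup>2 * ((1 + M) * (2 * (1 + M))) * A * z i"
        using A z_bd[of i] by (intro mult_right_mono) auto
      also have "\<dots> = D * (1 + M)\<^sup>2 * z (Suc i)"
        unfolding D_def z_def using beta by (simp add: power2_eq_square field_simps)
      also have "\<dots> \<le> k powr \<theta> * z (Suc i)"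
        using k_theta z_bd[of "Suc i"] by (intro mult_right_mono) auto
      finally show "c * A * z i \<le> k powr \<theta> * z (Suc i)" .
    qed
    finally have "ennreal (k powr \<theta>) * tail_modular \<Omega> r u (l (Suc i))
        \<le> ennreal (k powr \<theta>) * ennreal (z (Suc i))"
      using z_bd[of "Suc i"] by (simp add: ennreal_mult)
    then show ?case
      using k_ge(1) by (subst (asm) ennreal_mult_le_mult_iff) auto
  qed
  have "tail_modular \<Omega> r u (2 * k) \<le> ennreal (z i)" for i
    using tail_modular_antimono[OF l_ge(2)] main by (rule order_trans)
  moreover have "(\<lambda>i. ennreal (z i)) \<longlonglongrightarrow> ennreal 0"
    unfolding z_def using beta
    by (intro tendsto_ennrealI LIMSEQ_divide_realpow_zero) auto
  ultimately have "tail_modular \<Omega> r u (2 * k) \<le> ennreal 0"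
    by (intro LIMSEQ_le_const[where X = "\<lambda>i. ennreal (z i)"]) auto
  then have "tail_modular \<Omega> r u (2 * k) = 0" by simp
  then have "AE x in lebesgue. ennreal (u x powr r x) * indicator {x \<in> \<Omega>. 2 * k < u x} x = 0"
    unfolding tail_modular_def by (subst (asm) nn_integral_0_iff_AE) auto
  then show ?thesis
    unfolding k_def[symmetric]
  proof eventually_elim
    case (elim x)
    then show ?case using k_ge(1) by (auto simp: indicator_def split: if_splits)
  qed
qed

end

section \<open>Weak solutions and the energy inequality\<close>

lemma Wsp0_iff:
  fixes u :: "real^'n \<Rightarrow> real"
  shows "u \<in> Wsp0 s p \<Omega> \<longleftrightarrow>
    u \<in> borel_measurable lebesgue \<and>
    (\<integral>\<^sup>+x. ennreal (\<bar>u x\<bar> powr p (x, x)) \<partial>lebesgue) < \<infinity> \<and>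
    gagliardo_energy s p u < \<infinity> \<and>
    (AE x in lebesgue. x \<notin> \<Omega> \<longrightarrow> u x = 0)"
  unfolding Wsp0_def Wsp_def Lvar_def gagliardo_energy_def gagliardo_kernel_def
  by (auto simp: lebesgue_on_UNIV_eq)

lemma excess_in_Wsp0:
  fixes u :: "real^'n \<Rightarrow> real"
  assumes u: "u \<in> Wsp0 s p \<Omega>" and p: "\<And>z. 0 \<le> p z" and k: "0 \<le> k"
  shows "excess u k \<in> Wsp0 s p \<Omega>"
proof -
  have "\<bar>excess u k x\<bar> \<le> \<bar>u x\<bar>" for x using k by (auto simp: excess_def)
  then have "(\<integral>\<^sup>+x. ennreal (\<bar>excess u k x\<bar> powr p (x, x)) \<partial>lebesgue)
      \<le> (\<integral>\<^sup>+x. ennreal (\<bar>u x\<bar> powr p (x, x)) \<partial>lebesgue)"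
    using p by (intro nn_integral_mono ennreal_leI powr_mono2) auto
  moreover have "AE x in lebesgue. x \<notin> \<Omega> \<longrightarrow> excess u k x = 0"
    using u unfolding Wsp0_iff by (auto simp: excess_def k elim: eventually_mono)
  ultimately show ?thesis
    using u energy_excess_le[of p s u k] p unfolding Wsp0_iff by auto
qed

lemma weak_solution_uminus:
  fixes u :: "real^'n \<Rightarrow> real"
  assumes "weak_solution s p \<Omega> f u"
  shows "weak_solution s p \<Omega> (\<lambda>x t. - f x (- t)) (\<lambda>x. - u x)"
proof -
  have u: "u \<in> Wsp0 s p \<Omega>" using assms by (simp add: weak_solution_def)
  have abs: "\<bar>- u x - - u y\<bar> = \<bar>u x - u y\<bar>" for x y by simp
  have "(\<lambda>x. - u x) \<in> Wsp0 s p \<Omega>"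
    using u unfolding Wsp0_iff gagliardo_energy_def gagliardo_kernel_def abs by auto
  moreover have "(\<integral>(x, y). \<bar>- u x - - u y\<bar> powr (p (x, y) - 2) * (- u x - - u y) * (v x - v y)
             / norm (x - y) powr (real CARD('n) + s * p (x, y))
           \<partial>(lebesgue \<Otimes>\<^sub>M lebesgue))
        = (\<integral>x. - f x (- (- u x)) * v x \<partial>lebesgue_on \<Omega>)" if v: "v \<in> Wsp0 s p \<Omega>" for v
  proof -
    let ?F = "\<lambda>x y. \<bar>u x - u y\<bar> powr (p (x, y) - 2) * (u x - u y) * (v x - v y)
             / norm (x - y) powr (real CARD('n) + s * p (x, y))"
    have "\<bar>- u x - - u y\<bar> powr (p (x, y) - 2) * (- u x - - u y) * (v x - v y)
             / norm (x - y) powr (real CARD('n) + s * p (x, y)) = - ?F x y" for x y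
    proof -
      have "- u x - - u y = - (u x - u y)" by simp
      then show ?thesis
        by (simp only: abs_minus_cancel mult_minus_left minus_divide_left)
    qed
    then have "(\<integral>(x, y). \<bar>- u x - - u y\<bar> powr (p (x, y) - 2) * (- u x - - u y) * (v x - v y)
             / norm (x - y) powr (real CARD('n) + s * p (x, y)) \<partial>(lebesgue \<Otimes>\<^sub>M lebesgue))
        = - (\<integral>(x, y). ?F x y \<partial>(lebesgue \<Otimes>\<^sub>M lebesgue))"
      by (simp only: case_prod_unfold integral_minus)
    also have "\<dots> = - (\<integral>x. f x (u x) * v x \<partial>lebesgue_on \<Omega>)"
      using bspec[OF conjunct2[OF assms[unfolded weak_solution_def]] v] by (rule arg_cong)
    finally show ?thesis by simp
  qed
  ultimately show ?thesis unfolding weak_solution_def by (intro conjI ballI)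
qed

text \<open>
  The truncation difference \<open>c\<close> has the sign of \<open>a - b\<close> and is at most as large. The first bound makes
  the tested form coercive, the second makes its integrand integrable.
\<close>

lemma monotone_flux_bounds:
  fixes a b k P :: real
  assumes P: "1 \<le> P"
  defines "c \<equiv> max 0 (a - k) - max 0 (b - k)"
  shows "\<bar>c\<bar> powr P \<le> \<bar>a - b\<bar> powr (P - 2) * (a - b) * c"
    and "\<bar>a - b\<bar> powr (P - 2) * (a - b) * c \<le> \<bar>a - b\<bar> powr P"
proof -
  have c: "\<bar>c\<bar> \<le> \<bar>a - b\<bar>" "(a - b) * c = \<bar>a - b\<bar> * \<bar>c\<bar>"
  proof -
    show "\<bar>c\<bar> \<le> \<bar>a - b\<bar>" unfolding c_def by (simp add: max_def)
    have "0 \<le> (a - b) * c"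
      unfolding c_def by (cases "b \<le> a") (auto intro: mult_nonneg_nonneg mult_nonpos_nonpos)
    then show "(a - b) * c = \<bar>a - b\<bar> * \<bar>c\<bar>" by (simp add: abs_mult[symmetric])
  qed
  have flux: "\<bar>a - b\<bar> powr (P - 2) * (a - b) * c = \<bar>a - b\<bar> powr (P - 1) * \<bar>c\<bar>"
  proof (cases "a = b")
    case False
    then have "\<bar>a - b\<bar> powr (P - 1) = \<bar>a - b\<bar> powr (P - 2) * \<bar>a - b\<bar>"
      using powr_add[of "\<bar>a - b\<bar>" "P - 2" 1] by simp
    then show ?thesis using c(2) by (simp add: mult.assoc)
  qed (use c in auto)
  have split: "\<bar>t\<bar> powr P = \<bar>t\<bar> powr (P - 1) * \<bar>t\<bar>" for t :: real
    using powr_add[of "\<bar>t\<bar>" "P - 1" 1] by (cases "t = 0") auto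
  show "\<bar>c\<bar> powr P \<le> \<bar>a - b\<bar> powr (P - 2) * (a - b) * c"
    unfolding flux split using c P by (intro mult_right_mono powr_mono2) auto
  show "\<bar>a - b\<bar> powr (P - 2) * (a - b) * c \<le> \<bar>a - b\<bar> powr P"
    unfolding flux split[of "a - b"] using c by (intro mult_left_mono) auto
qed

text \<open>
  For a function that is not integrable the Bochner integral is \<open>0\<close>, so the bound holds for every \<open>g\<close>.
\<close>

lemma ennreal_integral_le_nn_integral:
  fixes g :: "'a \<Rightarrow> real"
  shows "ennreal (integral\<^sup>L M g) \<le> (\<integral>\<^sup>+x. ennreal \<bar>g x\<bar> \<partial>M)"
proof (cases "integrable M g")
  case True
  have "ennreal (integral\<^sup>L M g) \<le> ennreal \<bar>integral\<^sup>L M g\<bar>" by (intro ennreal_leI) simp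
  also have "\<dots> \<le> (\<integral>\<^sup>+x. ennreal \<bar>g x\<bar> \<partial>M)"
    using integral_norm_bound_ennreal[OF True] by simp
  finally show ?thesis .
qed (simp add: not_integrable_integral_eq)

text \<open>
  The truncation \<open>(u - k)\<^sup>+\<close> is an admissible test function. On its support \<open>u > 1\<close>, hence the growth
  bound times the test function is at most \<open>2 * C0 * u powr q\<close>.
\<close>

lemma caccioppoli_inequality:
  fixes u :: "real^'n \<Rightarrow> real"
  assumes sol: "weak_solution s p \<Omega> f u"
    and p_borel [measurable]: "p \<in> borel_measurable borel" and p1: "\<And>z. 1 \<le> p z"
    and Omega [measurable]: "\<Omega> \<in> sets lebesgue"
    and [measurable]: "r \<in> borel_measurable lebesgue"
    and q: "\<And>x. x \<in> \<Omega> \<Longrightarrow> 1 \<le> q x \<and> q x \<le> r x"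
    and C0: "0 < C0"
    and growth: "AE x in lebesgue_on \<Omega>. \<forall>t. \<bar>f x t\<bar> \<le> C0 * (1 + \<bar>t\<bar> powr (q x - 1))"
    and k: "1 \<le> k"
  shows "gagliardo_energy s p (excess u k) \<le> ennreal (2 * C0) * tail_modular \<Omega> r u k"
proof -
  let ?v = "excess u k"
  let ?M = "lebesgue \<Otimes>\<^sub>M lebesgue :: ((real^'n) \<times> (real^'n)) measure"
  define F where "F = (\<lambda>(x, y). \<bar>u x - u y\<bar> powr (p (x, y) - 2) * (u x - u y) * (?v x - ?v y)
             / norm (x - y) powr (real CARD('n) + s * p (x, y)))"
  have u: "u \<in> Wsp0 s p \<Omega>" using sol by (simp add: weak_solution_def)
  then have um [measurable]: "u \<in> borel_measurable lebesgue" unfolding Wsp0_iff by simp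
  have v: "?v \<in> Wsp0 s p \<Omega>"
    using u k p1 by (intro excess_in_Wsp0) (auto intro: order_trans[OF zero_le_one])
  note [measurable] = borel_measurable_norm_diff_lebesgue[unfolded case_prod_beta]
    borel_measurable_pair_lebesgue[OF p_borel]
  have F_meas [measurable]: "F \<in> borel_measurable ?M"
    unfolding F_def case_prod_beta prod.collapse by measurable
  have F_bounds: "gagliardo_kernel s p ?v x y \<le> F (x, y)" "F (x, y) \<le> gagliardo_kernel s p u x y"
    for x y
    using monotone_flux_bounds[OF p1[of "(x, y)"], where a = "u x" and b = "u y" and k = k]
    unfolding F_def gagliardo_kernel_def by (auto simp: excess_def intro!: divide_right_mono)
  have F0: "0 \<le> F z" for z
  proof -
    have "0 \<le> gagliardo_kernel s p ?v (fst z) (snd z)" by (simp add: gagliardo_kernel_def)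
    also have "\<dots> \<le> F z" using F_bounds(1)[of "fst z" "snd z"] by simp
    finally show ?thesis .
  qed
  have "(\<integral>\<^sup>+z. ennreal (norm (F z)) \<partial>?M) \<le> gagliardo_energy s p u"
    unfolding gagliardo_energy_def using F_bounds(2) F0
    by (intro nn_integral_mono) (auto intro!: ennreal_leI)
  also have "\<dots> < \<infinity>" using u unfolding Wsp0_iff by simp
  finally have F_int: "integrable ?M F" by (intro integrableI_bounded F_meas)
  have "gagliardo_energy s p ?v \<le> (\<integral>\<^sup>+z. ennreal (F z) \<partial>?M)"
    unfolding gagliardo_energy_def using F_bounds(1)
    by (intro nn_integral_mono) (auto intro!: ennreal_leI)
  also have "\<dots> = ennreal (integral\<^sup>L ?M F)"
    using F_int F0 by (intro nn_integral_eq_integral) auto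
  also have "integral\<^sup>L ?M F = (\<integral>x. f x (u x) * ?v x \<partial>lebesgue_on \<Omega>)"
    using bspec[OF conjunct2[OF sol[unfolded weak_solution_def]] v] unfolding F_def .
  also have "ennreal \<dots> \<le> (\<integral>\<^sup>+x. ennreal \<bar>f x (u x) * ?v x\<bar> \<partial>lebesgue_on \<Omega>)"
    by (rule ennreal_integral_le_nn_integral)
  also have "\<dots> \<le> (\<integral>\<^sup>+x. ennreal (2 * C0) * (ennreal (u x powr r x) * indicator {x \<in> \<Omega>. k < u x} x)
      \<partial>lebesgue_on \<Omega>)"
  proof (rule nn_integral_mono_AE)
    have "AE x in lebesgue_on \<Omega>. x \<in> \<Omega>" using Omega by (auto intro: AE_I2)
    with growth show "AE x in lebesgue_on \<Omega>. ennreal \<bar>f x (u x) * ?v x\<bar>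
        \<le> ennreal (2 * C0) * (ennreal (u x powr r x) * indicator {x \<in> \<Omega>. k < u x} x)"
    proof eventually_elim
      case (elim x)
      show ?case
      proof (cases "k < u x")
        case True
        have ux: "1 < u x" using True k by simp
        have "\<bar>f x (u x) * ?v x\<bar> = \<bar>f x (u x)\<bar> * (u x - k)"
          using True by (simp add: abs_mult excess_def)
        also have "\<dots> \<le> C0 * (1 + \<bar>u x\<bar> powr (q x - 1)) * u x"
        proof (intro mult_mono)
          show "\<bar>f x (u x)\<bar> \<le> C0 * (1 + \<bar>u x\<bar> powr (q x - 1))" using elim(1) by blast
        qed (use True k C0 in auto)
        also have "\<dots> \<le> C0 * (2 * u x powr (q x - 1)) * u x"
          using ux q[OF elim(2)] C0 ge_one_powr_ge_zero[of "u x" "q x - 1"]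
          by (intro mult_right_mono mult_left_mono) auto
        also have "\<dots> = 2 * C0 * u x powr q x"
          using ux powr_add[of "u x" "q x - 1" 1] by simp
        also have "\<dots> \<le> 2 * C0 * u x powr r x"
          using ux q[OF elim(2)] C0 by (intro mult_left_mono powr_mono) auto
        finally show ?thesis
          using True elim(2) C0 by (auto simp: ennreal_mult[symmetric] intro: ennreal_leI)
      qed (simp add: excess_def)
    qed
  qed
  also have "\<dots> = (\<integral>\<^sup>+x. ennreal (2 * C0) * (ennreal (u x powr r x) * indicator {x \<in> \<Omega>. k < u x} x)
      \<partial>lebesgue)"
    using Omega by (subst nn_integral_restrict_space)
      (auto intro!: nn_integral_cong simp: indicator_def)
  also have "\<dots> = ennreal (2 * C0) * tail_modular \<Omega> r u k"
    unfolding tail_modular_def by (rule nn_integral_cmult) measurable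
  finally show ?thesis .
qed

section \<open>Modular and norm of variable exponent spaces\<close>

lemma modular_scale_le:
  assumes [measurable]: "u \<in> borel_measurable M" "h \<in> borel_measurable M"
    and h: "\<And>x. x \<in> space M \<Longrightarrow> 1 \<le> h x"
    and c: "0 \<le> c" "c \<le> 1"
  shows "(\<integral>\<^sup>+x. ennreal (\<bar>c * u x\<bar> powr h x) \<partial>M) \<le> ennreal c * (\<integral>\<^sup>+x. ennreal (\<bar>u x\<bar> powr h x) \<partial>M)"
proof -
  have "(\<integral>\<^sup>+x. ennreal (\<bar>c * u x\<bar> powr h x) \<partial>M)
      \<le> (\<integral>\<^sup>+x. ennreal c * ennreal (\<bar>u x\<bar> powr h x) \<partial>M)"
  proof (intro nn_integral_mono)
    fix x assume "x \<in> space M"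
    then have "c powr h x \<le> c" using powr_mono'[of 1 "h x" c] h c by simp
    then show "ennreal (\<bar>c * u x\<bar> powr h x) \<le> ennreal c * ennreal (\<bar>u x\<bar> powr h x)"
      using c by (auto simp: abs_mult powr_mult ennreal_mult[symmetric] intro!: ennreal_leI mult_right_mono)
  qed
  also have "\<dots> = ennreal c * (\<integral>\<^sup>+x. ennreal (\<bar>u x\<bar> powr h x) \<partial>M)"
    by (rule nn_integral_cmult) measurable
  finally show ?thesis .
qed

text \<open>
  The norm is an infimum of admissible scales \<open>l\<close>. The factor \<open>2\<close> in the last bound provides an
  admissible \<open>l\<close> below \<open>2\<close> times the norm, so that the question whether the infimum is attained does
  not arise.
\<close>

lemma Lvar_norm_modular:
  fixes u h :: "'a::euclidean_space \<Rightarrow> real"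
  assumes [measurable]: "u \<in> borel_measurable (lebesgue_on D)" "h \<in> borel_measurable (lebesgue_on D)"
    and h: "\<And>x. x \<in> D \<Longrightarrow> 1 \<le> h x" "\<And>x. x \<in> D \<Longrightarrow> h x \<le> Q"
    and fin: "(\<integral>\<^sup>+x. ennreal (\<bar>u x\<bar> powr h x) \<partial>lebesgue_on D) < \<infinity>"
  shows "0 \<le> Lvar_norm D h u"
    and "Lvar_norm D h u = 0 \<Longrightarrow> AE x in lebesgue_on D. u x = 0"
    and "0 < Lvar_norm D h u \<Longrightarrow>
      (\<integral>\<^sup>+x. ennreal (\<bar>u x\<bar> powr h x) \<partial>lebesgue_on D) \<le> ennreal (max 1 ((2 * Lvar_norm D h u) powr Q))"
proof -
  let ?I = "\<lambda>w. \<integral>\<^sup>+x. ennreal (\<bar>w x\<bar> powr h x) \<partial>lebesgue_on D"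
  define S where "S = {l. 0 < l \<and> ?I (\<lambda>x. u x / l) \<le> 1}"
  have norm: "Lvar_norm D h u = Inf S" unfolding Lvar_norm_def S_def ..
  have h1: "1 \<le> h x" if "x \<in> space (lebesgue_on D)" for x using h that by simp
  obtain m where m: "0 \<le> m" "?I u = ennreal m"
    using fin by (cases "?I u") auto
  have "1 + m \<in> S"
  proof -
    have "?I (\<lambda>x. (1 / (1 + m)) * u x) \<le> ennreal (1 / (1 + m)) * ?I u"
      using m by (intro modular_scale_le h1) auto
    also have "\<dots> = ennreal (m / (1 + m))" using m by (simp add: ennreal_mult[symmetric])
    also have "\<dots> \<le> 1" using m by (auto simp: ennreal_le_1 divide_le_eq_1)
    finally show ?thesis unfolding S_def using m by (simp add: field_simps)
  qed
  then have ne: "S \<noteq> {}" by blast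
  have bdd: "bdd_below S" unfolding S_def by (intro bdd_belowI[of _ 0]) auto
  show nn: "0 \<le> Lvar_norm D h u"
    unfolding norm using ne by (intro cInf_greatest) (auto simp: S_def)
  show "AE x in lebesgue_on D. u x = 0" if zero: "Lvar_norm D h u = 0"
  proof -
    have "?I u \<le> ennreal e" if e: "0 < e" "e < 1" for e
    proof -
      obtain l where l: "l \<in> S" "l < e"
        using cInf_lessD[OF ne, of e] zero e unfolding norm by auto
      have "?I u = ?I (\<lambda>x. l * (u x / l))" using l unfolding S_def by simp
      also have "\<dots> \<le> ennreal l * ?I (\<lambda>x. u x / l)"
        using l e unfolding S_def by (intro modular_scale_le h1) auto
      also have "\<dots> \<le> ennreal l * 1" using l unfolding S_def by (intro mult_left_mono) auto
      also have "\<dots> \<le> ennreal e" using l by (auto intro: ennreal_leI)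
      finally show ?thesis .
    qed
    then have "m \<le> e" if "0 < e" "e < 1" for e using that m by (simp add: ennreal_le_iff)
    then have "m \<le> 0" by (meson dense_ge_bounded zero_less_one)
    then have "?I u = 0" using m by simp
    then have "AE x in lebesgue_on D. ennreal (\<bar>u x\<bar> powr h x) = 0"
      by (subst (asm) nn_integral_0_iff_AE) auto
    then show ?thesis by eventually_elim auto
  qed
  show "?I u \<le> ennreal (max 1 ((2 * Lvar_norm D h u) powr Q))" if pos: "0 < Lvar_norm D h u"
  proof -
    obtain l where l: "l \<in> S" "l < 2 * Lvar_norm D h u"
      using cInf_lessD[OF ne, of "2 * Inf S"] pos unfolding norm by auto
    define c where "c = max 1 ((2 * Lvar_norm D h u) powr Q)"
    have "?I u \<le> (\<integral>\<^sup>+x. ennreal c * ennreal (\<bar>u x / l\<bar> powr h x) \<partial>lebesgue_on D)"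
    proof (intro nn_integral_mono)
      fix x assume "x \<in> space (lebesgue_on D)"
      then have x: "1 \<le> h x" "h x \<le> Q" using h by auto
      have l0: "0 < l" using l unfolding S_def by simp
      have "l powr h x \<le> c"
      proof (cases "l \<le> 1")
        case True
        then have "l powr h x \<le> 1" using l0 x by (intro powr_le1) auto
        then show ?thesis unfolding c_def by simp
      next
        case False
        then have "l powr h x \<le> l powr Q" using x by (intro powr_mono) auto
        also have "\<dots> \<le> (2 * Lvar_norm D h u) powr Q" using l l0 x by (intro powr_mono2) auto
        finally show ?thesis unfolding c_def by simp
      qed
      moreover have "\<bar>u x\<bar> powr h x = l powr h x * \<bar>u x / l\<bar> powr h x"
      proof -
        have "\<bar>u x\<bar> = l * \<bar>u x / l\<bar>" using l0 by (simp add: abs_divide)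
        then show ?thesis by (metis powr_mult)
      qed
      ultimately show "ennreal (\<bar>u x\<bar> powr h x) \<le> ennreal c * ennreal (\<bar>u x / l\<bar> powr h x)"
        by (auto simp: ennreal_mult[symmetric] c_def intro!: ennreal_leI mult_right_mono)
    qed
    also have "\<dots> = ennreal c * ?I (\<lambda>x. u x / l)" by (rule nn_integral_cmult) measurable
    also have "\<dots> \<le> ennreal c * 1" using l unfolding S_def by (intro mult_left_mono) auto
    finally show ?thesis unfolding c_def by simp
  qed
qed

section \<open>Boundedness of weak solutions\<close>

text \<open>
  Subcriticality is equivalent to positivity of \<open>p - r (1 - s p / N)\<close>; by compactness this function has
  a positive minimum \<open>2 \<theta>\<close> on the closure of \<open>\<Omega>\<close>. Then \<open>\<epsilon>\<close> is chosen so small that the losses in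
  the exponents use up at most \<open>\<theta>\<close>, and uniform continuity provides \<open>\<rho>0\<close>.
\<close>

lemma subcritical_growth_exists:
  fixes \<Omega> :: "(real^'n) set" and s :: real
    and p :: "(real^'n) \<times> (real^'n) \<Rightarrow> real" and q :: "real^'n \<Rightarrow> real"
  assumes Omega: "\<Omega> \<noteq> {}" "open \<Omega>" "bounded \<Omega>" and s: "0 < s"
    and p: "continuous_on UNIV p" and inf: "1 < (INF z. ereal (p z))"
    and sup: "(SUP z. ereal (p z)) < ereal (real CARD('n) / s)"
    and q: "continuous_on (closure \<Omega>) q"
    and crit: "\<And>x. x \<in> closure \<Omega> \<Longrightarrow> q x < crit_exp s p x"
  obtains \<epsilon> \<rho>0 \<theta> p_hi Q r where "subcritical_growth s \<epsilon> \<rho>0 \<theta> p_hi Q \<Omega> p r"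
    and "\<And>x. x \<in> \<Omega> \<Longrightarrow> r x = max (p (x, x)) (q x)"
proof -
  define n where "n = real CARD('n)"
  have n: "1 \<le> n" unfolding n_def by (simp add: Suc_leI)
  obtain p_lo where p_lo: "1 < p_lo" "\<And>z. p_lo \<le> p z"
  proof -
    obtain c where c: "1 < ereal c" "ereal c < (INF z. ereal (p z))"
      using ereal_dense2[OF inf] by auto
    have "ereal c \<le> ereal (p z)" for z
      using less_imp_le[OF c(2)] INF_lower[of z UNIV "\<lambda>z. ereal (p z)"] by (meson UNIV_I order_trans)
    then show ?thesis using c that[of c] by simp
  qed
  obtain p_hi where p_hi: "p_hi < n / s" "\<And>z. p z \<le> p_hi"
  proof -
    obtain c where c: "(SUP z. ereal (p z)) < ereal c" "ereal c < ereal (n / s)"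
      using ereal_dense2[OF sup] unfolding n_def by auto
    have "ereal (p z) \<le> ereal c" for z
      using less_imp_le[OF c(1)] SUP_upper[of z UNIV "\<lambda>z. ereal (p z)"] by (meson UNIV_I order_trans)
    then show ?thesis using c that[of c] by simp
  qed
  have sp: "s * p z < n" for z
  proof -
    have "s * p z \<le> s * p_hi" using p_hi(2) s by simp
    also have "\<dots> < n" using p_hi(1) s by (simp add: field_simps)
    finally show ?thesis .
  qed
  define K where "K = closure \<Omega>"
  have K: "compact K" "K \<noteq> {}" "\<Omega> \<subseteq> K"
    unfolding K_def using Omega by (auto simp: compact_closure closure_subset)
  have diag: "continuous_on A (\<lambda>x. p (x, x))" for A
    by (intro continuous_on_compose2[OF p] continuous_intros) auto
  define r0 where "r0 = (\<lambda>x. max (p (x, x)) (q x))"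
  have r0_cont: "continuous_on K r0"
    unfolding r0_def K_def by (intro continuous_intros diag q)
  define c where "c = s / n"
  have c: "0 < c" "c \<le> s" unfolding c_def using s n by (auto simp: divide_le_eq)
  define gap where "gap = (\<lambda>x. p (x, x) - r0 x * (1 - c * p (x, x)))"
  have "continuous_on K gap"
    unfolding gap_def by (intro continuous_intros diag r0_cont)
  then obtain x0 where x0: "x0 \<in> K" "\<And>x. x \<in> K \<Longrightarrow> gap x0 \<le> gap x"
    using continuous_attains_inf[OF K(1,2)] by blast
  have gap_pos: "0 < gap x0"
  proof -
    let ?P = "p (x0, x0)"
    have P: "1 < ?P" "s * ?P < n" using p_lo(2)[of "(x0, x0)"] p_lo(1) sp[of "(x0, x0)"] by auto
    have "?P < n * ?P / (n - s * ?P)"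
    proof -
      have "0 < ?P * (s * ?P)" using P s by simp
      then show ?thesis using P by (simp add: field_simps)
    qed
    moreover have "q x0 < n * ?P / (n - s * ?P)"
      using crit x0(1) unfolding K_def crit_exp_def n_def by blast
    ultimately have "r0 x0 < n * ?P / (n - s * ?P)" unfolding r0_def by simp
    then have "r0 x0 * (n - s * ?P) < n * ?P" using P by (simp add: field_simps)
    then have "r0 x0 * (1 - c * ?P) < ?P" unfolding c_def using n by (simp add: field_simps)
    then show ?thesis unfolding gap_def by simp
  qed
  define \<theta> where "\<theta> = gap x0 / 2"
  have theta: "0 < \<theta>" unfolding \<theta>_def using gap_pos by simp
  obtain Q where Q: "\<And>x. x \<in> K \<Longrightarrow> r0 x \<le> Q"
    using continuous_attains_sup[OF K(1,2) r0_cont] by blast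
  have Q1: "1 \<le> Q"
    using Q[OF x0(1)] p_lo(1) p_lo(2)[of "(x0, x0)"] unfolding r0_def by linarith
  define \<epsilon> where "\<epsilon> = min (p_lo - 1) (\<theta> / (2 + s * Q))"
  have eps: "0 < \<epsilon>" "\<epsilon> \<le> p_lo - 1" "\<epsilon> * (2 + s * Q) \<le> \<theta>"
  proof -
    have *: "0 < 2 + s * Q" using s Q1 by (simp add: add_pos_pos)
    show "0 < \<epsilon>" "\<epsilon> \<le> p_lo - 1" unfolding \<epsilon>_def using p_lo(1) theta * by auto
    have "\<epsilon> \<le> \<theta> / (2 + s * Q)" unfolding \<epsilon>_def by simp
    then show "\<epsilon> * (2 + s * Q) \<le> \<theta>" using * by (simp add: field_simps)
  qed
  obtain B where B: "\<And>x. x \<in> \<Omega> \<Longrightarrow> norm x \<le> B" using Omega(3) by (auto simp: bounded_iff)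
  define H where "H = (cball 0 (B + 1) :: (real^'n) set)"
  have "uniformly_continuous_on (H \<times> H) p"
    unfolding H_def by (intro compact_uniformly_continuous compact_Times)
      (auto intro: continuous_on_subset[OF p])
  then obtain d1 where d1: "0 < d1"
    "\<And>z z'. z \<in> H \<times> H \<Longrightarrow> z' \<in> H \<times> H \<Longrightarrow> dist z' z < d1 \<Longrightarrow> dist (p z') (p z) < \<epsilon>"
    unfolding uniformly_continuous_on_def using eps(1) by metis
  have "uniformly_continuous_on K r0"
    by (intro compact_uniformly_continuous r0_cont K)
  then obtain d2 where d2: "0 < d2"
    "\<And>x y. x \<in> K \<Longrightarrow> y \<in> K \<Longrightarrow> dist y x < d2 \<Longrightarrow> dist (r0 y) (r0 x) < \<epsilon>"
    unfolding uniformly_continuous_on_def using eps(1) by metis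
  define \<rho>0 where "\<rho>0 = min 1 (min (d1 / 2) d2)"
  \<comment> \<open>\<open>q\<close> is controlled only on the closure of \<open>\<Omega>\<close>; the value \<open>0\<close> elsewhere makes \<open>r\<close> measurable on the whole space.\<close>
  define r where "r = (\<lambda>x. if x \<in> \<Omega> then r0 x else 0)"
  have osc_p: "p (x, x) - \<epsilon> \<le> p (x, y)" "p (x, x) - \<epsilon> \<le> p (y, y)"
    if "x \<in> \<Omega>" "dist x y < \<rho>0" for x y
  proof -
    have x: "norm x \<le> B" "0 \<le> B" using B[OF that(1)] norm_ge_zero order_trans by blast+
    have "norm y \<le> norm x + dist x y"
      by (metis dist_norm norm_minus_commute norm_triangle_sub)
    then have H: "x \<in> H" "y \<in> H" using x that(2) unfolding H_def \<rho>0_def by auto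
    have "dist (x, y) (x, x) \<le> dist x y" "dist (y, y) (x, x) \<le> 2 * dist x y"
    proof -
      show "dist (x, y) (x, x) \<le> dist x y" by (simp add: dist_Pair_Pair dist_commute)
      have "dist (y, y) (x, x) \<le> \<bar>dist y x\<bar> + \<bar>dist y x\<bar>"
        unfolding dist_Pair_Pair by (rule sqrt_sum_squares_le_sum_abs)
      then show "dist (y, y) (x, x) \<le> 2 * dist x y" by (simp add: dist_commute)
    qed
    moreover have "2 * dist x y < d1" using that(2) unfolding \<rho>0_def by simp
    ultimately have "dist (x, y) (x, x) < d1" "dist (y, y) (x, x) < d1"
      using zero_le_dist[of x y] by linarith+
    then have "dist (p (x, y)) (p (x, x)) < \<epsilon>" "dist (p (y, y)) (p (x, x)) < \<epsilon>"
      using H by (auto intro: d1(2))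
    then show "p (x, x) - \<epsilon> \<le> p (x, y)" "p (x, x) - \<epsilon> \<le> p (y, y)"
      by (auto simp: dist_real_def)
  qed
  have meas: "r \<in> borel_measurable lebesgue"
  proof -
    have "continuous_on \<Omega> r0" using r0_cont K(3) by (rule continuous_on_subset)
    then have "r0 \<in> borel_measurable (lebesgue_on \<Omega>)"
      using Omega(2) by (intro continuous_imp_measurable_on_sets_lebesgue) auto
    then have "(\<lambda>x. if x \<in> \<Omega> then r0 x else 0) \<in> borel_measurable lebesgue"
      using Omega(2) by (subst borel_measurable_if) auto
    then show ?thesis unfolding r_def .
  qed
  have "subcritical_growth s \<epsilon> \<rho>0 \<theta> p_hi Q \<Omega> p r"
  proof
    show "0 < s" "0 < \<epsilon>" "0 < \<theta>" by (fact s eps theta)+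
    show "0 < \<rho>0" "\<rho>0 \<le> 1" unfolding \<rho>0_def using d1 d2 by auto
    show "\<Omega> \<in> sets lebesgue" using Omega by auto
    show "p \<in> borel_measurable borel" using p by (rule borel_measurable_continuous_onI)
    show "r \<in> borel_measurable lebesgue" by (rule meas)
    show "1 \<le> p z" for z using p_lo(1) p_lo(2)[of z] by simp
    show "1 + \<epsilon> \<le> p (x, x)" for x using eps(2) p_lo(2)[of "(x, x)"] by simp
    show "p z \<le> p_hi" for z by (rule p_hi)
    show "s * p_hi \<le> real DIM(real^'n)"
      using p_hi(1) s unfolding n_def by (simp add: field_simps)
    show "p (x, x) \<le> r x" "r x \<le> Q" if "x \<in> \<Omega>" for x
      using that Q[of x] K(3) unfolding r_def by (auto simp: r0_def)
    show "p (x, x) - \<epsilon> \<le> p (x, y)" "p (x, x) - \<epsilon> \<le> p (y, y)"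
      if "x \<in> \<Omega>" "dist x y < \<rho>0" for x y by (rule osc_p[OF that])+
    show "r x - \<epsilon> \<le> r y" if "x \<in> \<Omega>" "y \<in> \<Omega>" "dist x y < \<rho>0" for x y
    proof -
      have "dist (r0 y) (r0 x) < \<epsilon>"
        using that K(3) by (intro d2(2)) (auto simp: \<rho>0_def dist_commute)
      then show ?thesis using that unfolding r_def by (auto simp: dist_real_def)
    qed
    show "m + \<theta> \<le> (p (x, x) - \<epsilon>) * (1 + s / real DIM(real^'n) * (m - \<epsilon>))"
      if x: "x \<in> \<Omega>" and m: "p (x, x) \<le> m" "m \<le> r x" for x m
    proof -
      let ?P = "p (x, x)"
      have xK: "x \<in> K" using x K(3) by blast
      have rx: "r x = r0 x" using x unfolding r_def by simp
      have m0: "0 \<le> m" using m p_lo(1) p_lo(2)[of "(x, x)"] by simp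
      have a: "c * ?P \<le> 1" unfolding c_def using sp[of "(x, x)"] n by simp
      have "m * (1 - c * ?P) \<le> r0 x * (1 - c * ?P)"
        using m rx a by (intro mult_right_mono) auto
      then have 1: "2 * \<theta> \<le> ?P - m * (1 - c * ?P)"
        using x0(2)[OF xK] unfolding \<theta>_def gap_def by simp
      have 2: "\<epsilon> * (1 + c * m + c * ?P) \<le> \<theta>"
      proof -
        have "c * m \<le> s * Q"
          using c s m0 m rx Q[OF xK] by (intro mult_mono) auto
        then have "\<epsilon> * (1 + c * m + c * ?P) \<le> \<epsilon> * (2 + s * Q)"
          using a eps(1) by (intro mult_left_mono) auto
        with eps(3) show ?thesis by (rule order_trans[rotated])
      qed
      have 3: "(A - \<epsilon>) * (1 + c * (m - \<epsilon>))
          = A + m * (c * A) - \<epsilon> * (1 + c * m + c * A) + c * \<epsilon>\<^sup>2" for A :: real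
        by (simp add: algebra_simps power2_eq_square)
      have 4: "0 \<le> c * \<epsilon>\<^sup>2" using c by simp
      have 5: "m + \<theta> \<le> A + m * B - X + V"
        if "2 * \<theta> \<le> A - m * (1 - B)" "X \<le> \<theta>" "0 \<le> V" for A B X V :: real
      proof -
        have "m * (1 - B) = m - m * B" by (simp add: right_diff_distrib)
        with that show ?thesis by linarith
      qed
      have "m + \<theta> \<le> (?P - \<epsilon>) * (1 + c * (m - \<epsilon>))"
        unfolding 3 by (rule 5[OF 1 2 4])
      then show ?thesis unfolding c_def n_def by simp
    qed
  qed
  moreover have "r x = max (p (x, x)) (q x)" if "x \<in> \<Omega>" for x
    using that unfolding r_def r0_def by simp
  ultimately show thesis by (rule that)
qed

text \<open>
  The gain of integrability applied to \<open>u\<close> and \<open>- u\<close> bounds the two tails; where \<open>\<bar>u\<bar>\<close> is below the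
  levels, boundedness of \<open>\<Omega>\<close> suffices.
\<close>

lemma Wsp0_modular_finite:
  fixes u :: "real^'n \<Rightarrow> real"
  assumes growth: "subcritical_growth s \<epsilon> \<rho>0 \<theta> p_hi Q \<Omega> p r"
    and bdd: "bounded \<Omega>" and u: "u \<in> Wsp0 s p \<Omega>"
  shows "(\<integral>\<^sup>+x. ennreal (\<bar>u x\<bar> powr r x) * indicator \<Omega> x \<partial>lebesgue) < \<infinity>"
proof -
  interpret subcritical_growth s \<epsilon> \<rho>0 \<theta> p_hi Q \<Omega> p r by (rule growth)
  have um [measurable]: "u \<in> borel_measurable lebesgue"
    and u_off: "AE x in lebesgue. x \<notin> \<Omega> \<longrightarrow> u x = 0"
    and u_energy: "gagliardo_energy s p u < \<infinity>"
    and u_Lp: "(\<integral>\<^sup>+x. ennreal (\<bar>u x\<bar> powr p (x, x)) \<partial>lebesgue) < \<infinity>"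
    using u unfolding Wsp0_iff by auto
  have tail: "\<exists>k\<ge>1. tail_modular \<Omega> r (\<lambda>x. \<sigma> * u x) k < \<infinity>" if sigma: "\<bar>\<sigma>\<bar> = 1" for \<sigma>
  proof (rule tail_modular_finite)
    have abs: "\<bar>\<sigma> * u x - \<sigma> * u y\<bar> = \<bar>u x - u y\<bar>" for x y
      using sigma by (simp add: right_diff_distrib[symmetric] abs_mult)
    show "gagliardo_energy s p (\<lambda>x. \<sigma> * u x) < \<infinity>"
      using u_energy unfolding gagliardo_energy_def gagliardo_kernel_def abs .
    show "AE y in lebesgue. y \<notin> \<Omega> \<longrightarrow> \<sigma> * u y = 0"
      using u_off by eventually_elim auto
    have "tail_modular \<Omega> (\<lambda>x. p (x, x)) (\<lambda>x. \<sigma> * u x) 1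
        \<le> (\<integral>\<^sup>+x. ennreal (\<bar>u x\<bar> powr p (x, x)) \<partial>lebesgue)"
      unfolding tail_modular_def
    proof (intro nn_integral_mono)
      fix x
      have "\<bar>\<sigma> * u x\<bar> = \<bar>u x\<bar>" using sigma by (simp add: abs_mult)
      then have "\<sigma> * u x = \<bar>u x\<bar>" if "1 < \<sigma> * u x" using that by linarith
      then show "ennreal ((\<sigma> * u x) powr p (x, x)) * indicator {x \<in> \<Omega>. 1 < \<sigma> * u x} x
          \<le> ennreal (\<bar>u x\<bar> powr p (x, x))"
        by (auto simp: indicator_def)
    qed
    then show "tail_modular \<Omega> (\<lambda>x. p (x, x)) (\<lambda>x. \<sigma> * u x) 1 < \<infinity>"
      using u_Lp by (rule le_less_trans)
  qed measurable
  obtain k where k: "1 \<le> k" "tail_modular \<Omega> r u k < \<infinity>"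
    using tail[of 1] by auto
  obtain l where l: "1 \<le> l" "tail_modular \<Omega> r (\<lambda>x. - u x) l < \<infinity>"
    using tail[of "-1"] by auto
  define h where "h = max k l"
  have tails [measurable]:
    "(\<lambda>x. ennreal (u x powr r x) * indicator {x \<in> \<Omega>. k < u x} x) \<in> borel_measurable lebesgue"
    "(\<lambda>x. ennreal ((- u x) powr r x) * indicator {x \<in> \<Omega>. l < - u x} x) \<in> borel_measurable lebesgue"
    by measurable
  have "(\<integral>\<^sup>+x. ennreal (\<bar>u x\<bar> powr r x) * indicator \<Omega> x \<partial>lebesgue)
      \<le> (\<integral>\<^sup>+x. ennreal (h powr Q) * indicator \<Omega> x
          + (ennreal (u x powr r x) * indicator {x \<in> \<Omega>. k < u x} x
            + ennreal ((- u x) powr r x) * indicator {x \<in> \<Omega>. l < - u x} x) \<partial>lebesgue)"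
  proof (intro nn_integral_mono)
    fix x
    have le_sum: "b \<le> a + b" for a b :: ennreal by (rule add_increasing) auto
    consider "x \<notin> \<Omega>" | "x \<in> \<Omega>" "k < u x" | "x \<in> \<Omega>" "l < - u x"
      | "x \<in> \<Omega>" "\<bar>u x\<bar> \<le> h" "\<not> k < u x" "\<not> l < - u x"
      unfolding h_def by linarith
    then show "ennreal (\<bar>u x\<bar> powr r x) * indicator \<Omega> x
        \<le> ennreal (h powr Q) * indicator \<Omega> x
          + (ennreal (u x powr r x) * indicator {x \<in> \<Omega>. k < u x} x
            + ennreal ((- u x) powr r x) * indicator {x \<in> \<Omega>. l < - u x} x)"
    proof cases
      case 2
      then have "\<bar>u x\<bar> = u x" "\<not> l < - u x" using k l by auto
      with 2 show ?thesis by (simp only: mem_Collect_eq simp_thms indicator_simps mult_1_right mult_zero_right add_0_right) (rule le_sum)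
    next
      case 3
      then have "\<bar>u x\<bar> = - u x" "\<not> k < u x" using k l by auto
      with 3 show ?thesis by (simp only: mem_Collect_eq simp_thms indicator_simps mult_1_right mult_zero_right add_0_left) (rule le_sum)
    next
      case 4
      have "\<bar>u x\<bar> powr r x \<le> h powr r x"
        using 4 p_le_r[OF 4(1)] p_ge_1[of "(x, x)"] by (intro powr_mono2) auto
      also have "\<dots> \<le> h powr Q" using r_le[OF 4(1)] k unfolding h_def by (intro powr_mono) auto
      finally show ?thesis using 4 by (auto intro: ennreal_leI)
    qed auto
  qed
  also have "\<dots> = ennreal (h powr Q) * emeasure lebesgue \<Omega>
      + (tail_modular \<Omega> r u k + tail_modular \<Omega> r (\<lambda>x. - u x) l)"
    unfolding tail_modular_def
    by (simp add: nn_integral_add nn_integral_cmult_indicator)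
  also have "\<dots> < \<infinity>"
  proof -
    have "emeasure lebesgue \<Omega> < \<infinity>"
      using bounded_set_imp_lmeasurable[OF bdd sets_Omega] unfolding fmeasurable_def by simp
    then show ?thesis using k(2) l(2) by (simp add: ennreal_mult_less_top del: emeasure_completion)
  qed
  finally show ?thesis .
qed

lemma weak_solution_bounded:
  fixes u :: "real^'n \<Rightarrow> real"
  assumes growth: "subcritical_growth s \<epsilon> \<rho>0 \<theta> p_hi Q \<Omega> p r"
    and sol: "weak_solution s p \<Omega> f u"
    and q: "\<And>x. x \<in> \<Omega> \<Longrightarrow> 1 \<le> q x \<and> q x \<le> r x"
    and C0: "0 < C0"
    and f: "AE x in lebesgue_on \<Omega>. \<forall>t. \<bar>f x t\<bar> \<le> C0 * (1 + \<bar>t\<bar> powr (q x - 1))"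
    and M: "0 \<le> M" "(\<integral>\<^sup>+x. ennreal (\<bar>u x\<bar> powr r x) * indicator \<Omega> x \<partial>lebesgue) \<le> ennreal M"
  shows "AE x in lebesgue. x \<in> \<Omega> \<longrightarrow>
    \<bar>u x\<bar> \<le> 2 * (subcritical_growth.sup_const TYPE(real^'n) s \<rho>0 \<theta> p_hi Q (2 * C0)
      * (1 + M) powr subcritical_growth.sup_exponent \<theta>)"
proof -
  interpret subcritical_growth s \<epsilon> \<rho>0 \<theta> p_hi Q \<Omega> p r by (rule growth)
  have upper: "AE x in lebesgue. x \<in> \<Omega> \<longrightarrow>
      w x \<le> 2 * (sup_const (2 * C0) * (1 + M) powr sup_exponent)"
    if w: "weak_solution s p \<Omega> g w" "\<And>x. \<bar>w x\<bar> = \<bar>u x\<bar>"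
      and g: "AE x in lebesgue_on \<Omega>. \<forall>t. \<bar>g x t\<bar> \<le> C0 * (1 + \<bar>t\<bar> powr (q x - 1))" for w g
  proof (rule de_giorgi_upper_bound)
    have W: "w \<in> Wsp0 s p \<Omega>" using w(1) by (simp add: weak_solution_def)
    then show "w \<in> borel_measurable lebesgue" "AE y in lebesgue. y \<notin> \<Omega> \<longrightarrow> w y = 0"
      unfolding Wsp0_iff by auto
    show "gagliardo_energy s p (excess w k) \<le> ennreal (2 * C0) * tail_modular \<Omega> r w k"
      if "1 \<le> k" for k
      using w(1) p_borel p_ge_1 sets_Omega r_measurable q C0 g that by (rule caccioppoli_inequality)
    have "tail_modular \<Omega> r w 1 \<le> (\<integral>\<^sup>+x. ennreal (\<bar>u x\<bar> powr r x) * indicator \<Omega> x \<partial>lebesgue)"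
      unfolding tail_modular_def w(2)[symmetric]
      by (intro nn_integral_mono) (auto simp: indicator_def)
    with M(2) show "tail_modular \<Omega> r w 1 \<le> ennreal M" by (rule order_trans[rotated])
  qed (use C0 M in auto)
  have g: "AE x in lebesgue_on \<Omega>. \<forall>t. \<bar>- f x (- t)\<bar> \<le> C0 * (1 + \<bar>t\<bar> powr (q x - 1))"
    using f by eventually_elim (metis abs_minus_cancel)
  show ?thesis
    using upper[OF sol refl f] upper[OF weak_solution_uminus[OF sol] abs_minus_cancel g]
    by eventually_elim auto
qed

theorem theorem4p2:
  fixes \<Omega> :: "(real^'n) set"
    and s C0 :: real
    and p :: "(real^'n) \<times> (real^'n) \<Rightarrow> real"
    and f :: "real^'n \<Rightarrow> real \<Rightarrow> real"
    and q :: "real^'n \<Rightarrow> real"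
  assumes "CARD('n) \<ge> 2"
    and "bounded_lipschitz_domain \<Omega>"
    and "0 < s" and "s < 1"
    and "continuous_on UNIV p"
    and "\<And>x y. p (x, y) = p (y, x)"
    and "1 < (INF z. ereal (p z))"
    and "(SUP z. ereal (p z)) < ereal (real CARD('n) / s)"
    and "log_holder_type p"
    and "caratheodory \<Omega> f"
    and "C0 > 0"
    and "q \<in> C_plus (closure \<Omega>)"
    and "\<And>x. x \<in> closure \<Omega> \<Longrightarrow> q x < crit_exp s p x"
    and "AE x in lebesgue_on \<Omega>. \<forall>t. \<bar>f x t\<bar> \<le> C0 * (1 + \<bar>t\<bar> powr (q x - 1))"
  shows "(\<forall>u. weak_solution s p \<Omega> f u \<longrightarrow> u \<in> Linfty \<Omega>) \<and>
    (\<exists>C \<tau>1 \<tau>2 :: real. \<forall>u. weak_solution s p \<Omega> f u \<longrightarrow>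
       Linfty_norm \<Omega> u \<le>
         ereal (C * max (Lvar_norm \<Omega> (\<lambda>x. max (p (x, x)) (q x)) u powr \<tau>1)
                        (Lvar_norm \<Omega> (\<lambda>x. max (p (x, x)) (q x)) u powr \<tau>2)))"
proof -
  have Omega: "\<Omega> \<noteq> {}" "open \<Omega>" "bounded \<Omega>"
    using assms(2) unfolding bounded_lipschitz_domain_def by auto
  have q_cont: "continuous_on (closure \<Omega>) q" and q_inf: "1 < (INF x\<in>closure \<Omega>. ereal (q x))"
    using assms(12) unfolding C_plus_def by auto
  have q1: "1 \<le> q x" if "x \<in> \<Omega>" for x
  proof -
    have "x \<in> closure \<Omega>" using that closure_subset by blast
    then have "1 < ereal (q x)"
      by (intro less_le_trans[OF q_inf] INF_lower)
    then show ?thesis by simp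
  qed
  obtain \<epsilon> \<rho>0 \<theta> p_hi Q r where growth: "subcritical_growth s \<epsilon> \<rho>0 \<theta> p_hi Q \<Omega> p r"
    and r: "\<And>x. x \<in> \<Omega> \<Longrightarrow> r x = max (p (x, x)) (q x)"
    using subcritical_growth_exists[OF Omega assms(3,5,7,8) q_cont assms(13)] by metis
  interpret subcritical_growth s \<epsilon> \<rho>0 \<theta> p_hi Q \<Omega> p r by (rule growth)
  define qt where "qt = (\<lambda>x. max (p (x, x)) (q x))"
  define K where "K = sup_const (2 * C0)"
  define \<tau> where "\<tau> = sup_exponent"
  define C where "C = 2 * K * 2 powr \<tau> * 2 powr (Q * \<tau>)"
  have K: "2 \<le> K" unfolding K_def by (rule sup_const_ge_2)
  have tau: "0 < \<tau>" unfolding \<tau>_def sup_exponent_def using theta_pos by (simp add: add_pos_pos)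
  have r1: "1 \<le> r x" if "x \<in> \<Omega>" for x
    using p_le_r[OF that] p_ge_1[of "(x, x)"] by simp
  have bound: "Linfty_norm \<Omega> u \<le> ereal (C * max (Lvar_norm \<Omega> qt u powr 0)
        (Lvar_norm \<Omega> qt u powr (Q * \<tau>))) \<and> u \<in> borel_measurable (lebesgue_on \<Omega>)"
    if sol: "weak_solution s p \<Omega> f u" for u
  proof -
    have u: "u \<in> Wsp0 s p \<Omega>" using sol by (simp add: weak_solution_def)
    then have "u \<in> borel_measurable lebesgue" unfolding Wsp0_iff by simp
    then have um [measurable]: "u \<in> borel_measurable (lebesgue_on \<Omega>)"
      by (rule measurable_restrict_space1)
    have rm: "r \<in> borel_measurable (lebesgue_on \<Omega>)"
      using r_measurable by (rule measurable_restrict_space1)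
    have qtm: "qt \<in> borel_measurable (lebesgue_on \<Omega>)"
      using rm by (rule measurable_cong[THEN iffD1, rotated]) (simp add: qt_def r)
    let ?I = "\<integral>\<^sup>+x. ennreal (\<bar>u x\<bar> powr r x) * indicator \<Omega> x \<partial>lebesgue"
    obtain M where M: "0 \<le> M" "?I = ennreal M"
      using Wsp0_modular_finite[OF growth Omega(3) u] by (cases ?I) auto
    have I_eq: "(\<integral>\<^sup>+x. ennreal (\<bar>u x\<bar> powr qt x) \<partial>lebesgue_on \<Omega>) = ?I"
      using sets_Omega by (subst nn_integral_restrict_space)
        (auto intro!: nn_integral_cong simp: indicator_def qt_def r)
    have qt_bounds: "1 \<le> qt x" "qt x \<le> Q" if "x \<in> \<Omega>" for x
      using r1[OF that] r_le[OF that] r[OF that] unfolding qt_def by auto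
    define \<Lambda> where "\<Lambda> = Lvar_norm \<Omega> qt u"
    have fin: "(\<integral>\<^sup>+x. ennreal (\<bar>u x\<bar> powr qt x) \<partial>lebesgue_on \<Omega>) < \<infinity>"
      unfolding I_eq M by simp
    have norm: "0 \<le> \<Lambda>" "\<Lambda> = 0 \<Longrightarrow> AE x in lebesgue_on \<Omega>. u x = 0"
      "0 < \<Lambda> \<Longrightarrow> ennreal M \<le> ennreal (max 1 ((2 * \<Lambda>) powr Q))"
      unfolding \<Lambda>_def M(2)[symmetric] I_eq[symmetric]
      by (rule Lvar_norm_modular[OF um qtm _ _ fin, where Q = Q]; use qt_bounds in blast)+
    have um_ereal: "(\<lambda>x. ereal \<bar>u x\<bar>) \<in> borel_measurable (lebesgue_on \<Omega>)" by measurable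
    have essbound: "Linfty_norm \<Omega> u \<le> ereal c" if "AE x in lebesgue_on \<Omega>. \<bar>u x\<bar> \<le> c" for c
      unfolding Linfty_norm_def by (intro esssup_I um_ereal) (use that in simp)
    have "Linfty_norm \<Omega> u \<le> ereal (C * max (\<Lambda> powr 0) (\<Lambda> powr (Q * \<tau>)))"
    proof (cases "\<Lambda> = 0")
      case True
      have "AE x in lebesgue_on \<Omega>. \<bar>u x\<bar> \<le> 0"
        using norm(2)[OF True] by eventually_elim simp
      from essbound[OF this] show ?thesis using True by simp
    next
      case False
      then have pos: "0 < \<Lambda>" using norm(1) by simp
      have Q: "1 \<le> Q"
      proof -
        obtain x where "x \<in> \<Omega>" using Omega(1) by blast
        from order_trans[OF r1[OF this] r_le[OF this]] show ?thesis .
      qed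
      define X where "X = max 1 ((2 * \<Lambda>) powr Q)"
      have MX: "M \<le> X" using norm(3)[OF pos] unfolding X_def by (subst (asm) ennreal_le_iff) auto
      have ae: "AE x in lebesgue. x \<in> \<Omega> \<longrightarrow> \<bar>u x\<bar> \<le> 2 * (K * (1 + M) powr \<tau>)"
        unfolding K_def \<tau>_def
        by (rule weak_solution_bounded[OF growth sol _ assms(11,14) M(1) eq_refl[OF M(2)]])
          (use q1 r in auto)
      have le: "2 * (K * (1 + M) powr \<tau>) \<le> C * max (\<Lambda> powr 0) (\<Lambda> powr (Q * \<tau>))"
      proof -
        have "(1 + M) powr \<tau> \<le> (2 * X) powr \<tau>"
          using MX M(1) tau unfolding X_def by (intro powr_mono2) auto
        also have "\<dots> = 2 powr \<tau> * X powr \<tau>" by (rule powr_mult)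
        also have "X powr \<tau> \<le> 2 powr (Q * \<tau>) * max 1 (\<Lambda> powr (Q * \<tau>))"
        proof (cases "(2 * \<Lambda>) powr Q \<le> 1")
          case True
          have "1 * 1 \<le> 2 powr (Q * \<tau>) * max 1 (\<Lambda> powr (Q * \<tau>))"
            using Q tau by (intro mult_mono ge_one_powr_ge_zero) auto
          then show ?thesis using True unfolding X_def by simp
        next
          case False
          then have "X = (2 * \<Lambda>) powr Q" unfolding X_def by simp
          then have "X powr \<tau> = 2 powr (Q * \<tau>) * \<Lambda> powr (Q * \<tau>)"
            by (simp only: powr_powr powr_mult)
          then show ?thesis by (auto intro: mult_left_mono)
        qed
        finally have "(1 + M) powr \<tau> \<le> 2 powr \<tau> * (2 powr (Q * \<tau>) * max 1 (\<Lambda> powr (Q * \<tau>)))"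
          by simp
        then have "2 * K * (1 + M) powr \<tau>
            \<le> 2 * K * (2 powr \<tau> * (2 powr (Q * \<tau>) * max 1 (\<Lambda> powr (Q * \<tau>))))"
          using K by (intro mult_left_mono) auto
        moreover have "\<Lambda> powr 0 = 1" using pos by simp
        ultimately show ?thesis unfolding C_def by (simp only: mult.assoc)
      qed
      have "AE x in lebesgue. x \<in> \<Omega> \<longrightarrow> \<bar>u x\<bar> \<le> C * max (\<Lambda> powr 0) (\<Lambda> powr (Q * \<tau>))"
        using ae by eventually_elim (use le order_trans in blast)
      then have "AE x in lebesgue_on \<Omega>. \<bar>u x\<bar> \<le> C * max (\<Lambda> powr 0) (\<Lambda> powr (Q * \<tau>))"
        using sets_Omega by (subst AE_restrict_space_iff) auto
      then show ?thesis by (rule essbound)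
    qed
    with um show ?thesis unfolding \<Lambda>_def by blast
  qed
  show ?thesis
  proof (intro conjI allI impI exI)
    fix u assume "weak_solution s p \<Omega> f u"
    note b = bound[OF this]
    have "Linfty_norm \<Omega> u < \<infinity>"
      by (rule le_less_trans[OF conjunct1[OF b]]) simp
    with b show "u \<in> Linfty \<Omega>"
      unfolding Linfty_def by blast
  next
    fix u assume "weak_solution s p \<Omega> f u"
    from bound[OF this] show "Linfty_norm \<Omega> u \<le>
         ereal (C * max (Lvar_norm \<Omega> (\<lambda>x. max (p (x, x)) (q x)) u powr 0)
                        (Lvar_norm \<Omega> (\<lambda>x. max (p (x, x)) (q x)) u powr (Q * \<tau>)))"
      unfolding qt_def by blast
  qed
qed

end
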